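(* Let $\alpha_0>0$, $\lambda_0>0$, and let $u\in\mathcal E((0,\infty),L^2(S^2))$ satisfy $\|u\|_{L^2(\mathbb R^3)}=1$, $u_\lambda=0$ in $L^2(S^2)$ only for $\lambda=\lambda_0$ in $(0,\infty)$, and $1+\alpha_0\gamma(\langle\langle u,u\rangle\rangle,\lambda_0)=0$. For $\alpha>0$ let $H_\alpha=H_0+\alpha\langle\cdot,u\rangle u$ on $L^2(\mathbb R^3)$, where $H_0=-\Delta$. Assume in addition that $u'_{\lambda_0}\ne0$. Then for any fixed $h\in\mathbb R$, $$\lim_{\alpha\to\alpha_0}R^{(\alpha)}_{\lambda_h(\alpha)}=-\frac{2i}{h+i}\,\langle\langle\cdot,e(\lambda_0)\rangle\rangle\,e(\lambda_0)\quad\text{in Hilbert–Schmidt norm on }L^2(S^2),$$ where $e(\lambda_0)=u'_{\lambda_0}/|||u'_{\lambda_0}|||$.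
   Context: Inner products are linear in the first argument. $H_0$ is the self-adjoint realization of $-\Delta$ on $L^2(\mathbb R^3)$ with domain $\{v:|\xi|^2\hat v\in L^2\}$; $H_\alpha$ has the same domain. $S^2$ is the unit sphere in $\mathbb R^3$ with surface measure; $\langle\langle\cdot,\cdot\rangle\rangle$ and $|||\cdot|||$ are the inner product and norm of $L^2(S^2)$. The unitary $U:L^2(\mathbb R^3)\to L^2([0,\infty),L^2(S^2))$, $(Uv)_\lambda(\omega)=2^{-1/2}\lambda^{1/4}\hat v(\sqrt\lambda\,\omega)=:v_\lambda(\omega)$ ($\hat v$ the unitary Fourier transform), diagonalizes $H_0$ as multiplication by $\lambda$; vectors $v\in L^2(\mathbb R^3)$ are identified with $(v_\lambda)_\lambda$. The function $\langle\langle v,w\rangle\rangle:\mathbb R\to\mathbb C$ is $\langle\langle v_\lambda,w_\lambda\rangle\rangle$ for $\lambda>0$ and $0$ for $\lambda\le0$. $\mathcal E((0,\infty),L^2(S^2))$ is the space of strongly smooth $\lambda\mapsto v_\lambda\in L^2(S^2)$ on $(0,\infty)$ such that $v_\lambda$ and all its strong derivatives decrease rapidly as $\lambda\to\infty$ and as $\lambda\to0^+$, i.e. $\sup_{\lambda\ge1}\lambda^m|||v^{(k)}_\lambda|||<\infty$ and $\sup_{0<\lambda\le1}\lambda^{-m}|||v^{(k)}_\lambda|||<\infty$ for all integers $m,k\ge0$; then $\langle\langle v,w\rangle\rangle\in\mathcal S(\mathbb R)$ for $v,w$ in this space. $u'_{\lambda_0}$ is the strong derivative at $\lambda_0$. For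 $f\in\mathcal S(\mathbb R)$, $\gamma(f,\lambda)=\lim_{\epsilon\to0^+}\int_{|x-\lambda|\ge\epsilon}\frac{f(x)}{x-\lambda}dx$. For $\lambda>0$: $G_1(\alpha,\lambda)=1+\alpha\gamma(\langle\langle u,u\rangle\rangle,\lambda)$, $G_2(\alpha,\lambda)=\alpha\pi|||u_\lambda|||^2$, $G=G_1+iG_2$. $G(\alpha,\lambda)\neq 0$ for $\alpha>0$, $\alpha\ne\alpha_0$, $\lambda>0$. Let $\phi_\lambda=u_\lambda/(\lambda-\lambda_0)$ for $\lambda\ne\lambda_0$, $\phi_{\lambda_0}=u'_{\lambda_0}$ (an eigenvector of $H_{\alpha_0}$ for $\lambda_0$). Let $J\subset(0,\infty)$ be an open interval containing $\alpha_0$ and $\alpha\mapsto\lambda(\alpha)\in(0,\infty)$ a $C^1$ function on $J$ with $\lambda(\alpha_0)=\lambda_0$ and $G_1(\alpha,\lambda(\alpha))=0$ (these exist by the implicit function theorem). For $\alpha\in J$ put $\kappa(\alpha)=\pi|||u_{\lambda(\alpha)}|||^2/\|\phi\|^2$ and $\lambda_h(\alpha)=\lambda(\alpha)+h\kappa(\alpha)$ (positive for $\alpha$ near $\alpha_0$). For $\alpha>0$, $\alpha\ne\alpha_0$, the wave operators $\Omega^{(\alpha)}_\pm=\mathrm{s\text{-}lim}_{t\to\pm\infty}e^{itH_\alpha}e^{-itH_0}$ exist and are complete; $S^{(\alpha)}=\Omega_+^{(\alpha)*}\Omega_-^{(\alpha)}$ decomposes as $US^{(\alpha)}U^{-1}=\{S^{(\alpha)}_\lambda\}$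 with scattering matrix (known formula, used for every $\lambda>0$) $S^{(\alpha)}_\lambda=I-\frac{2\pi i\alpha}{G(\alpha,\lambda)}\langle\langle\cdot,u_\lambda\rangle\rangle u_\lambda$. Put $R^{(\alpha)}_\lambda=S^{(\alpha)}_\lambda-I=-\frac{2\pi i\alpha}{G(\alpha,\lambda)}\langle\langle\cdot,u_\lambda\rangle\rangle u_\lambda$. Limits $\alpha\to\alpha_0$ are over $\alpha\ne\alpha_0$. *)

theory Defs
  imports "HOL-Analysis.Analysis"
begin

section \<open>Complex \<open>L\<^sup>2\<close> spaces\<close>

text \<open>A type carries a fixed reference measure; \<open>'a L2\<close> is the space of classes, modulo
  almost-everywhere equality, of square-integrable functions from \<open>'a\<close> to the complex numbers.\<close>

class measured =
  fixes vol :: "'a measure"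

definition square_integrable :: "('a::measured \<Rightarrow> complex) \<Rightarrow> bool" where
  "square_integrable f \<longleftrightarrow> f \<in> borel_measurable vol \<and> integrable vol (\<lambda>x. (cmod (f x))\<^sup>2)"

definition L2_rel :: "('a::measured \<Rightarrow> complex) \<Rightarrow> ('a \<Rightarrow> complex) \<Rightarrow> bool" where
  "L2_rel f g \<longleftrightarrow> square_integrable f \<and> square_integrable g \<and> (AE x in vol. f x = g x)"

lemma square_integrable_zero: "square_integrable (\<lambda>x. 0)"
  by (simp add: square_integrable_def)

lemma square_integrable_add:
  assumes "square_integrable f" "square_integrable g"
  shows "square_integrable (\<lambda>x. f x + g x)"
proof -
  have m [measurable]: "f \<in> borel_measurable vol" "g \<in> borel_measurable vol"
    using assms by (auto simp: square_integrable_def)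
  have "(cmod (a + b))\<^sup>2 \<le> 2 * (cmod a)\<^sup>2 + 2 * (cmod b)\<^sup>2" for a b :: complex
  proof -
    have "(cmod (a + b))\<^sup>2 \<le> (cmod a + cmod b)\<^sup>2"
      by (simp add: norm_triangle_ineq power_mono)
    also have "\<dots> \<le> 2 * (cmod a)\<^sup>2 + 2 * (cmod b)\<^sup>2"
      using sum_squares_bound[of "cmod a" "cmod b"] by (simp add: power2_sum)
    finally show ?thesis .
  qed
  moreover have "integrable vol (\<lambda>x. 2 * (cmod (f x))\<^sup>2 + 2 * (cmod (g x))\<^sup>2)"
    using assms by (auto simp: square_integrable_def)
  ultimately have "integrable vol (\<lambda>x. (cmod (f x + g x))\<^sup>2)"
    by (intro Bochner_Integration.integrable_bound[OF \<open>integrable vol (\<lambda>x. 2 * (cmod (f x))\<^sup>2 + _ x)\<close>])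
       (auto intro!: AE_I2)
  then show ?thesis by (simp add: square_integrable_def)
qed

lemma square_integrable_scale:
  assumes "square_integrable f"
  shows "square_integrable (\<lambda>x. c * f x)"
  using assms by (auto simp: square_integrable_def norm_mult power_mult_distrib)

lemma square_integrable_uminus:
  "square_integrable f \<Longrightarrow> square_integrable (\<lambda>x. - f x)"
  using square_integrable_scale[of f "-1"] by simp

lemma square_integrable_diff:
  "square_integrable f \<Longrightarrow> square_integrable g \<Longrightarrow> square_integrable (\<lambda>x. f x - g x)"
  using square_integrable_add[of f "\<lambda>x. - g x"] square_integrable_uminus[of g] by simp

lemma integrable_mult_cnj:
  assumes "square_integrable f" "square_integrable g"
  shows "integrable vol (\<lambda>x. f x * cnj (g x))"
proof -
  have m [measurable]: "f \<in> borel_measurable vol" "g \<in> borel_measurable vol"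
    using assms by (auto simp: square_integrable_def)
  have m2 [measurable]: "(\<lambda>x. cnj (g x)) \<in> borel_measurable vol"
    by (rule measurable_compose[OF m(2)]) (intro borel_measurable_continuous_onI continuous_intros)
  have I: "integrable vol (\<lambda>x. (cmod (f x))\<^sup>2 + (cmod (g x))\<^sup>2)"
    using assms by (auto simp: square_integrable_def)
  show ?thesis
  proof (rule Bochner_Integration.integrable_bound[OF I])
    have "cmod a * cmod b \<le> (cmod a)\<^sup>2 + (cmod b)\<^sup>2" for a b
    proof -
      have "0 \<le> cmod a * cmod b" by simp
      then show ?thesis using sum_squares_bound[of "cmod a" "cmod b"] unfolding mult.assoc by linarith
    qed
    then show "AE x in vol. norm (f x * cnj (g x)) \<le> norm ((cmod (f x))\<^sup>2 + (cmod (g x))\<^sup>2)"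
      by (intro AE_I2) (simp add: norm_mult)
  qed measurable
qed

lemma L2_rel_map1:
  fixes f f' :: "'a::measured \<Rightarrow> complex"
  assumes "L2_rel f f'" "\<And>f :: 'a \<Rightarrow> complex. square_integrable f \<Longrightarrow> square_integrable (\<lambda>x. h (f x))"
  shows "L2_rel (\<lambda>x. h (f x)) (\<lambda>x. h (f' x))"
proof -
  have "AE x in vol. f x = f' x" using assms by (simp add: L2_rel_def)
  then have "AE x in vol. h (f x) = h (f' x)" by eventually_elim simp
  then show ?thesis using assms by (auto simp: L2_rel_def)
qed

lemma L2_rel_map2:
  fixes f f' g g' :: "'a::measured \<Rightarrow> complex"
  assumes "L2_rel f f'" "L2_rel g g'"
    "\<And>f g :: 'a \<Rightarrow> complex. square_integrable f \<Longrightarrow> square_integrable g \<Longrightarrow> square_integrable (\<lambda>x. h (f x) (g x))"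
  shows "L2_rel (\<lambda>x. h (f x) (g x)) (\<lambda>x. h (f' x) (g' x))"
proof -
  have "AE x in vol. f x = f' x" "AE x in vol. g x = g' x" using assms by (simp_all add: L2_rel_def)
  then have "AE x in vol. h (f x) (g x) = h (f' x) (g' x)" by eventually_elim simp
  then show ?thesis using assms by (auto simp: L2_rel_def)
qed

lemma AE_eq_trans:
  assumes "AE x in M. f x = g x" "AE x in M. g x = h x"
  shows "AE x in M. f x = h x"
  using assms by eventually_elim simp

quotient_type (overloaded) 'a L2 = "'a::measured \<Rightarrow> complex" / partial: L2_rel
proof (rule part_equivpI)
  show "\<exists>x. L2_rel x x"
    using square_integrable_zero by (auto simp: L2_rel_def)
  show "symp L2_rel"
    by (simp add: symp_def L2_rel_def eq_commute)
  show "transp L2_rel"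
    unfolding transp_def L2_rel_def
    using AE_eq_trans by blast
qed

lift_definition scaleC :: "complex \<Rightarrow> 'a::measured L2 \<Rightarrow> 'a L2" (infixr \<open>*\<^sub>C\<close> 75)
  is "\<lambda>c f x. c * f x"
  by (erule L2_rel_map1) (auto intro: square_integrable_scale)

lift_definition cinner :: "'a::measured L2 \<Rightarrow> 'a L2 \<Rightarrow> complex"
  is "\<lambda>f g. \<integral>x. f x * cnj (g x) \<partial>vol"
proof -
  fix f f' g g' :: "'a \<Rightarrow> complex"
  assume *: "L2_rel f f'" "L2_rel g g'"
  have "AE x in vol. f x = f' x" "AE x in vol. g x = g' x"
    using * by (simp_all add: L2_rel_def)
  then have "AE x in vol. f x * cnj (g x) = f' x * cnj (g' x)"
    by eventually_elim simp
  moreover have "(\<lambda>x. f x * cnj (g x)) \<in> borel_measurable vol"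
    "(\<lambda>x. f' x * cnj (g' x)) \<in> borel_measurable vol"
    using * integrable_mult_cnj by (auto simp: L2_rel_def intro!: borel_measurable_integrable)
  ultimately show "(\<integral>x. f x * cnj (g x) \<partial>vol) = (\<integral>x. f' x * cnj (g' x) \<partial>vol)"
    by (intro integral_cong_AE)
qed

instantiation L2 :: (measured) real_vector
begin

lift_definition zero_L2 :: "'a L2" is "\<lambda>x. 0"
  by (auto simp: L2_rel_def square_integrable_zero)

lift_definition plus_L2 :: "'a L2 \<Rightarrow> 'a L2 \<Rightarrow> 'a L2" is "\<lambda>f g x. f x + g x"
  by (erule (1) L2_rel_map2) (auto intro: square_integrable_add)

lift_definition minus_L2 :: "'a L2 \<Rightarrow> 'a L2 \<Rightarrow> 'a L2" is "\<lambda>f g x. f x - g x"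
  by (erule (1) L2_rel_map2) (auto intro: square_integrable_diff)

lift_definition uminus_L2 :: "'a L2 \<Rightarrow> 'a L2" is "\<lambda>f x. - f x"
  by (erule L2_rel_map1) (auto intro: square_integrable_uminus)

definition scaleR_L2 :: "real \<Rightarrow> 'a L2 \<Rightarrow> 'a L2" where
  "scaleR_L2 r f = complex_of_real r *\<^sub>C f"

instance
proof
  fix a b c :: "'a L2" and r s :: real
  show "a + b + c = a + (b + c)"
    by transfer (auto simp: L2_rel_def square_integrable_add algebra_simps)
  show "a + b = b + a"
    by transfer (auto simp: L2_rel_def square_integrable_add algebra_simps)
  show "0 + a = a"
    by transfer (auto simp: L2_rel_def)
  show "- a + a = 0"
    by transfer (auto simp: L2_rel_def square_integrable_zero)
  show "a - b = a + - b"
    by transfer (auto simp: L2_rel_def square_integrable_diff)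
  show "r *\<^sub>R (a + b) = r *\<^sub>R a + r *\<^sub>R b"
    unfolding scaleR_L2_def
    by transfer (auto simp: L2_rel_def square_integrable_scale square_integrable_add ring_distribs)
  show "(r + s) *\<^sub>R a = r *\<^sub>R a + s *\<^sub>R a"
    unfolding scaleR_L2_def
    by transfer (auto simp: L2_rel_def square_integrable_scale square_integrable_add ring_distribs)
  show "r *\<^sub>R s *\<^sub>R a = (r * s) *\<^sub>R a"
    unfolding scaleR_L2_def
    by transfer (auto simp: L2_rel_def mult.assoc intro: square_integrable_scale)
  show "1 *\<^sub>R a = a"
    unfolding scaleR_L2_def by transfer (auto simp: L2_rel_def)
qed

end

lemma cinner_add_left: "cinner (x + y) z = cinner x z + cinner y z"
  by transfer (auto simp: L2_rel_def distrib_right integrable_mult_cnj)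

lemma cinner_scaleC_left: "cinner (c *\<^sub>C x) y = c * cinner x y"
  by transfer (simp add: mult.assoc)

lemma cinner_commute: "cinner x y = cnj (cinner y x)"
  by transfer (subst Bochner_Integration.integral_cnj [symmetric],
      simp only: complex_cnj_mult complex_cnj_cnj mult.commute)

lemma cinner_self_nonneg: "0 \<le> Re (cinner x x)"
proof transfer
  fix f :: "'a \<Rightarrow> complex"
  have eq: "(\<integral>x. f x * cnj (f x) \<partial>vol) = complex_of_real (\<integral>x. (cmod (f x))\<^sup>2 \<partial>vol)"
    by (simp only: complex_norm_square [symmetric] integral_complex_of_real)
  show "0 \<le> Re (\<integral>x. f x * cnj (f x) \<partial>vol)"
    unfolding eq by simp
qed

lemma cinner_self_eq_0: "Re (cinner x x) = 0 \<longleftrightarrow> x = 0"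
proof transfer
  fix f :: "'a \<Rightarrow> complex"
  assume "L2_rel f f"
  then have sq: "square_integrable f" by (simp add: L2_rel_def)
  have eq: "(\<integral>x. f x * cnj (f x) \<partial>vol) = complex_of_real (\<integral>x. (cmod (f x))\<^sup>2 \<partial>vol)"
    by (simp only: complex_norm_square [symmetric] integral_complex_of_real)
  have "(\<integral>x. (cmod (f x))\<^sup>2 \<partial>vol) = 0 \<longleftrightarrow> (AE x in vol. (cmod (f x))\<^sup>2 = 0)"
    using sq by (intro integral_nonneg_eq_0_iff_AE) (auto simp: square_integrable_def)
  then show "(Re (\<integral>x. f x * cnj (f x) \<partial>vol) = 0) = L2_rel f (\<lambda>x. 0)"
    unfolding eq using sq by (simp add: L2_rel_def square_integrable_zero)
qed

instantiation L2 :: (measured) real_inner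
begin

definition inner_L2 :: "'a L2 \<Rightarrow> 'a L2 \<Rightarrow> real" where
  "inner_L2 f g = Re (cinner f g)"

definition norm_L2 :: "'a L2 \<Rightarrow> real" where
  "norm_L2 f = sqrt (Re (cinner f f))"

definition sgn_L2 :: "'a L2 \<Rightarrow> 'a L2" where
  "sgn_L2 f = f /\<^sub>R norm f"

definition dist_L2 :: "'a L2 \<Rightarrow> 'a L2 \<Rightarrow> real" where
  "dist_L2 f g = norm (f - g)"

definition uniformity_L2 :: "('a L2 \<times> 'a L2) filter" where
  "uniformity_L2 = (INF e\<in>{0<..}. principal {(f, g). dist f g < e})"

definition open_L2 :: "'a L2 set \<Rightarrow> bool" where
  "open_L2 S = (\<forall>f\<in>S. \<forall>\<^sub>F (f', g) in uniformity. f' = f \<longrightarrow> g \<in> S)"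

instance
proof
  fix x y z :: "'a L2" and r :: real
  show "x \<bullet> y = y \<bullet> x"
    unfolding inner_L2_def by (subst cinner_commute) simp
  show "(x + y) \<bullet> z = x \<bullet> z + y \<bullet> z"
    by (simp add: inner_L2_def cinner_add_left)
  show "r *\<^sub>R x \<bullet> y = r * (x \<bullet> y)"
    by (simp add: inner_L2_def scaleR_L2_def cinner_scaleC_left)
  show "0 \<le> x \<bullet> x"
    by (simp add: inner_L2_def cinner_self_nonneg)
  show "(x \<bullet> x = 0) = (x = 0)"
    by (simp add: inner_L2_def cinner_self_eq_0)
  show "norm x = sqrt (x \<bullet> x)"
    by (simp add: norm_L2_def inner_L2_def)
qed (simp_all add: dist_L2_def sgn_L2_def uniformity_L2_def open_L2_def)

end


section \<open>Operators on an \<open>L\<^sup>2\<close> space\<close>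

definition rank_one :: "'a::measured L2 \<Rightarrow> 'a L2 \<Rightarrow> 'a L2" where
  "rank_one w = (\<lambda>v. cinner v w *\<^sub>C w)"

definition bounded_clinear :: "('a::measured L2 \<Rightarrow> 'b::measured L2) \<Rightarrow> bool" where
  "bounded_clinear T \<longleftrightarrow> bounded_linear T \<and> (\<forall>c v. T (c *\<^sub>C v) = c *\<^sub>C T v)"

definition unitary :: "('a::measured L2 \<Rightarrow> 'a L2) \<Rightarrow> bool" where
  "unitary T \<longleftrightarrow> bounded_clinear T \<and> surj T \<and> (\<forall>v. norm (T v) = norm v)"

definition orthonormal :: "'a::measured L2 set \<Rightarrow> bool" where
  "orthonormal B \<longleftrightarrow> (\<forall>e\<in>B. norm e = 1) \<and> (\<forall>e\<in>B. \<forall>e'\<in>B. e \<noteq> e' \<longrightarrow> cinner e e' = 0)"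

definition orthonormal_basis :: "'a::measured L2 set \<Rightarrow> bool" where
  "orthonormal_basis B \<longleftrightarrow> orthonormal B \<and> (\<forall>v. (\<forall>e\<in>B. cinner v e = 0) \<longrightarrow> v = 0)"

lemma ex_orthonormal_basis: "\<exists>B :: 'a::measured L2 set. orthonormal_basis B"
proof -
  have "\<exists>M\<in>Collect orthonormal. \<forall>X\<in>Collect orthonormal. M \<subseteq> X \<longrightarrow> X = (M :: 'a L2 set)"
  proof (rule subset_Zorn)
    fix C :: "'a L2 set set"
    assume C: "subset.chain (Collect orthonormal) C"
    have "orthonormal (\<Union>C)"
      unfolding orthonormal_def
    proof (intro conjI ballI impI)
      fix e assume "e \<in> \<Union>C"
      then show "norm e = 1"
        using C by (auto simp: subset.chain_def orthonormal_def)
    next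
      fix e e' assume "e \<in> \<Union>C" "e' \<in> \<Union>C" and ne: "e \<noteq> e'"
      then obtain X Y where XY: "X \<in> C" "Y \<in> C" "e \<in> X" "e' \<in> Y" by blast
      have "X \<subseteq> Y \<or> Y \<subseteq> X" using C XY by (auto simp: subset_chain_def)
      then obtain Z where "Z \<in> C" "e \<in> Z" "e' \<in> Z" using XY by blast
      then show "cinner e e' = 0"
        using C ne by (auto simp: subset.chain_def orthonormal_def)
    qed
    then show "\<exists>U\<in>Collect orthonormal. \<forall>X\<in>C. X \<subseteq> U" by blast
  qed
  then obtain M :: "'a L2 set" where M: "orthonormal M"
    and max: "\<And>X. orthonormal X \<Longrightarrow> M \<subseteq> X \<Longrightarrow> X = M" by blast
  have "v = 0" if v: "\<forall>e\<in>M. cinner v e = 0" for v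
  proof (rule ccontr)
    assume "v \<noteq> 0"
    define w where "w = v /\<^sub>R norm v"
    have w: "norm w = 1" using \<open>v \<noteq> 0\<close> by (simp add: w_def)
    have o1: "cinner w e = 0" if "e \<in> M" for e
      using v that by (simp add: w_def scaleR_L2_def cinner_scaleC_left)
    then have o2: "cinner e w = 0" if "e \<in> M" for e
      using that cinner_commute[of e w] by simp
    have "orthonormal (insert w M)"
      using M w o1 o2 by (auto simp: orthonormal_def)
    then have "w \<in> M" using max by blast
    then have "Re (cinner w w) = 0" using o1 by simp
    then show False using w by (simp add: norm_L2_def)
  qed
  then show ?thesis using M by (auto simp: orthonormal_basis_def)
qed

definition hilbert_schmidt :: "('a::measured L2 \<Rightarrow> 'a L2) \<Rightarrow> bool" where
  "hilbert_schmidt T \<longleftrightarrow> bounded_clinear T \<and>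
     (\<forall>B. orthonormal_basis B \<longrightarrow> (\<lambda>e. (norm (T e))\<^sup>2) summable_on B)"

text \<open>The value does not depend on the orthonormal basis.\<close>

definition hs_norm :: "('a::measured L2 \<Rightarrow> 'a L2) \<Rightarrow> real" where
  "hs_norm T = sqrt (\<Sum>\<^sub>\<infinity>e\<in>(SOME B. orthonormal_basis B). (norm (T e))\<^sup>2)"

text \<open>Since \<open>infsum\<close> is 0 on non-summable families, membership in the Hilbert-Schmidt class is
  required separately.\<close>

definition tendsto_hs ::
  "('b \<Rightarrow> 'a::measured L2 \<Rightarrow> 'a L2) \<Rightarrow> ('a L2 \<Rightarrow> 'a L2) \<Rightarrow> 'b filter \<Rightarrow> bool" where
  "tendsto_hs T T0 F \<longleftrightarrow> hilbert_schmidt T0 \<and> (\<forall>\<^sub>F x in F. hilbert_schmidt (T x)) \<and>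
     ((\<lambda>x. hs_norm (\<lambda>v. T x v - T0 v)) \<longlongrightarrow> 0) F"


section \<open>The spaces \<open>L\<^sup>2(\<real>\<^sup>3)\<close> and \<open>L\<^sup>2(S\<^sup>2)\<close>\<close>

instantiation vec :: (euclidean_space, finite) measured
begin
definition vol_vec :: "('a ^ 'b) measure" where "vol_vec = lborel"
instance ..
end

typedef S2 = "sphere (0 :: real^3) 1"
  by (rule exI [of _ "axis 1 1"]) (simp add: norm_axis_1)

definition spherical_coordinates :: "real \<times> real \<Rightarrow> S2" where
  "spherical_coordinates = (\<lambda>(\<theta>, \<phi>). Abs_S2 (vector [sin \<theta> * cos \<phi>, sin \<theta> * sin \<phi>, cos \<theta>]))"

instantiation S2 :: measured
begin

definition vol_S2 :: "S2 measure" where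
  "vol_S2 = distr
     (density lborel (\<lambda>(\<theta>, \<phi>). ennreal (indicator ({0..pi} \<times> {0..2 * pi}) (\<theta>, \<phi>) * sin \<theta>)))
     (vimage_algebra UNIV Rep_S2 borel) spherical_coordinates"

instance ..

end


section \<open>The Fourier transform and the spectral representation of the Laplacian\<close>

definition truncated_fourier :: "nat \<Rightarrow> (real^3) L2 \<Rightarrow> real^3 \<Rightarrow> complex" where
  "truncated_fourier n v = (\<lambda>\<xi>. complex_of_real ((2 * pi) powr (-3/2)) *
     (LINT x:cball 0 (real n)|lborel. cis (- (x \<bullet> \<xi>)) * rep_L2 v x))"

text \<open>By Plancherel's theorem the truncated transforms are square-integrable and converge in
  \<open>L\<^sup>2\<close> to the unitary Fourier transform.\<close>

definition fourier :: "(real^3) L2 \<Rightarrow> (real^3) L2" where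
  "fourier v = lim (\<lambda>n. abs_L2 (truncated_fourier n v))"

text \<open>\<open>spectral v l\<close> is the fibre at \<open>l > 0\<close> of the unitary map onto
  \<open>L\<^sup>2([0,\<infinity>), L\<^sup>2(S\<^sup>2))\<close>.  It depends on the representative of the transform chosen
  by \<open>rep_L2\<close> only for \<open>l\<close> in a null set, and is used only almost everywhere.\<close>

definition spectral :: "(real^3) L2 \<Rightarrow> real \<Rightarrow> S2 L2" where
  "spectral v l = abs_L2 (\<lambda>\<omega>. complex_of_real (2 powr (-1/2) * l powr (1/4)) *
     rep_L2 (fourier v) (sqrt l *\<^sub>R Rep_S2 \<omega>))"


section \<open>Hamiltonians and scattering\<close>

text \<open>Unbounded operators are represented by their graphs.\<close>

definition H_free :: "((real^3) L2 \<times> (real^3) L2) set" where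
  "H_free = {(v, w). AE \<xi> in lborel.
     rep_L2 (fourier w) \<xi> = complex_of_real ((norm \<xi>)\<^sup>2) * rep_L2 (fourier v) \<xi>}"

definition H_pert :: "(real^3) L2 \<Rightarrow> real \<Rightarrow> ((real^3) L2 \<times> (real^3) L2) set" where
  "H_pert u \<alpha> = {(v, w + complex_of_real \<alpha> *\<^sub>C rank_one u v) | v w. (v, w) \<in> H_free}"

text \<open>\<open>V t = exp (i t H)\<close>, characterised as in Stone's theorem: a strongly continuous
  one-parameter unitary group with generator exactly \<open>i H\<close>, domain included.\<close>

definition unitary_group ::
  "('a::measured L2 \<times> 'a L2) set \<Rightarrow> (real \<Rightarrow> 'a L2 \<Rightarrow> 'a L2) \<Rightarrow> bool" where
  "unitary_group H V \<longleftrightarrow>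
     (\<forall>t. unitary (V t)) \<and> (\<forall>s t. V (s + t) = V s \<circ> V t) \<and>
     (\<forall>v. continuous_on UNIV (\<lambda>t. V t v)) \<and>
     (\<forall>v w. (v, w) \<in> H \<longleftrightarrow> ((\<lambda>t. V t v) has_vector_derivative \<i> *\<^sub>C w) (at 0))"

definition wave_operator ::
  "('a::measured L2 \<times> 'a L2) set \<Rightarrow> ('a L2 \<times> 'a L2) set \<Rightarrow> real filter \<Rightarrow> ('a L2 \<Rightarrow> 'a L2) \<Rightarrow> bool"
  where
  "wave_operator H0 H F \<Omega> \<longleftrightarrow> (\<exists>V0 V. unitary_group H0 V0 \<and> unitary_group H V \<and>
     (\<forall>v. ((\<lambda>t. V t (V0 (- t) v)) \<longlongrightarrow> \<Omega> v) F))"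

text \<open>\<open>S = \<Omega>\<^sub>+\<^sup>* \<Omega>\<^sub>-\<close>, with the adjoint written out.\<close>

definition scattering_operator ::
  "('a::measured L2 \<times> 'a L2) set \<Rightarrow> ('a L2 \<times> 'a L2) set \<Rightarrow> ('a L2 \<Rightarrow> 'a L2) \<Rightarrow> bool" where
  "scattering_operator H0 H S \<longleftrightarrow>
     (\<exists>\<Omega>p \<Omega>m. wave_operator H0 H at_top \<Omega>p \<and> wave_operator H0 H at_bot \<Omega>m \<and>
       (\<forall>v w. cinner (S v) w = cinner (\<Omega>m v) (\<Omega>p w)))"

text \<open>The decomposition determines the scattering matrix only for almost every energy.\<close>

definition scattering_matrix ::
  "((real^3) L2 \<times> (real^3) L2) set \<Rightarrow> (real \<Rightarrow> S2 L2 \<Rightarrow> S2 L2) \<Rightarrow> bool" where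
  "scattering_matrix H Sm \<longleftrightarrow>
     (\<exists>S. scattering_operator H_free H S \<and>
       (\<forall>v. AE l in lborel. l > 0 \<longrightarrow> spectral (S v) l = Sm l (spectral v l)))"


section \<open>Fibre functions and the stationary quantities\<close>

definition strong_deriv :: "nat \<Rightarrow> (real \<Rightarrow> 'a::real_normed_vector) \<Rightarrow> real \<Rightarrow> 'a" where
  "strong_deriv k v = ((\<lambda>g l. vector_derivative g (at l)) ^^ k) v"

definition rapid_smooth :: "(real \<Rightarrow> 'a::real_normed_vector) set" where
  "rapid_smooth = {v. \<forall>k. (\<forall>l>0. strong_deriv k v differentiable at l) \<and>
     (\<forall>m::nat. bdd_above ((\<lambda>l. l ^ m * norm (strong_deriv k v l)) ` {1..}) \<and>
               bdd_above ((\<lambda>l. norm (strong_deriv k v l) / l ^ m) ` {0<..1}))}"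

definition fibre_inner :: "(real \<Rightarrow> 'a::measured L2) \<Rightarrow> (real \<Rightarrow> 'a L2) \<Rightarrow> real \<Rightarrow> complex" where
  "fibre_inner v w l = (if l > 0 then cinner (v l) (w l) else 0)"

text \<open>Norm of \<open>L\<^sup>2([0,\<infinity>), L\<^sup>2(S\<^sup>2))\<close>, i.e. of the corresponding vector of
  \<open>L\<^sup>2(\<real>\<^sup>3)\<close>.\<close>

definition fibre_norm :: "(real \<Rightarrow> 'a::measured L2) \<Rightarrow> real" where
  "fibre_norm v = sqrt (LINT l:{0<..}|lborel. (norm (v l))\<^sup>2)"

definition pv_integral :: "(real \<Rightarrow> complex) \<Rightarrow> real \<Rightarrow> complex" where
  "pv_integral f l =
     Lim (at_right 0) (\<lambda>\<epsilon>. LINT x:{x. \<bar>x - l\<bar> \<ge> \<epsilon>}|lborel. f x / complex_of_real (x - l))"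

definition G1 :: "(real \<Rightarrow> 'a::measured L2) \<Rightarrow> real \<Rightarrow> real \<Rightarrow> complex" where
  "G1 u \<alpha> l = 1 + complex_of_real \<alpha> * pv_integral (fibre_inner u u) l"

definition G2 :: "(real \<Rightarrow> 'a::measured L2) \<Rightarrow> real \<Rightarrow> real \<Rightarrow> real" where
  "G2 u \<alpha> l = \<alpha> * pi * (norm (u l))\<^sup>2"

definition G :: "(real \<Rightarrow> 'a::measured L2) \<Rightarrow> real \<Rightarrow> real \<Rightarrow> complex" where
  "G u \<alpha> l = G1 u \<alpha> l + \<i> * complex_of_real (G2 u \<alpha> l)"

definition eigen_fibre :: "(real \<Rightarrow> 'a::measured L2) \<Rightarrow> real \<Rightarrow> real \<Rightarrow> 'a L2" where
  "eigen_fibre u l0 l =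
     (if l = l0 then strong_deriv 1 u l0 else u l /\<^sub>R (l - l0))"

definition kappa :: "(real \<Rightarrow> 'a::measured L2) \<Rightarrow> real \<Rightarrow> (real \<Rightarrow> real) \<Rightarrow> real \<Rightarrow> real" where
  "kappa u l0 lam \<alpha> = pi * (norm (u (lam \<alpha>)))\<^sup>2 / (fibre_norm (eigen_fibre u l0))\<^sup>2"

end

theory Submission
  imports Defs "HOL-Probability.Sinc_Integral"
begin

text \<open>Since \<open>u\<close> vanishes at \<open>\<lambda>\<^sub>0\<close>, \<open>|||u\<^sub>\<lambda>|||\<^sup>2 = (\<lambda> - \<lambda>\<^sub>0)\<^sup>2 q(\<lambda>)\<close> with
  \<open>q = |||\<phi>|||\<^sup>2\<close> locally Lipschitz, and expanding \<open>(x - \<lambda>\<^sub>0)\<^sup>2\<close> around \<open>\<lambda>\<close> gives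
  \<open>\<gamma>(\<lambda>) = c + (\<lambda> - \<lambda>\<^sub>0) \<parallel>\<phi>\<parallel>\<^sup>2 + (\<lambda> - \<lambda>\<^sub>0)\<^sup>2 \<Gamma>(\<lambda>)\<close>, where \<open>\<Gamma>\<close>, the principal value
  transform of \<open>q\<close>, is continuous at \<open>\<lambda>\<^sub>0\<close>.
  The resonance condition gives \<open>G\<^sub>1(\<alpha>, \<lambda>\<^sub>0) = 1 - \<alpha>/\<alpha>\<^sub>0\<close>, so \<open>\<delta> = \<lambda>(\<alpha>) - \<lambda>\<^sub>0\<close> is nonzero for
  \<open>\<alpha> \<noteq> \<alpha>\<^sub>0\<close>.  Subtracting \<open>G\<^sub>1(\<alpha>, \<lambda>(\<alpha>)) = 0\<close> then yields
  \<open>G(\<alpha>, \<lambda>\<^sub>h(\<alpha>)) = \<alpha> \<delta>\<^sup>2 Z\<close> with \<open>Z \<rightarrow> \<pi> |||u'|||\<^sup>2 (h + i)\<close>, while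
  \<open>u\<close> at \<open>\<lambda>\<^sub>h(\<alpha>)\<close> equals \<open>(1 + o(1)) \<delta> \<phi>\<close>; the factors \<open>\<delta>\<^sup>2\<close> cancel.\<close>

subsection \<open>Complex inner products and rank-one operators\<close>

lemma scaleC_add_right: "c *\<^sub>C (x + y) = c *\<^sub>C x + c *\<^sub>C (y :: 'a::measured L2)"
  by transfer (auto simp: L2_rel_def square_integrable_scale square_integrable_add ring_distribs)

lemma scaleC_add_left: "(c + d) *\<^sub>C x = c *\<^sub>C x + d *\<^sub>C (x :: 'a::measured L2)"
  by transfer (auto simp: L2_rel_def square_integrable_scale square_integrable_add ring_distribs)

lemma scaleC_scaleC: "c *\<^sub>C (d *\<^sub>C x) = (c * d) *\<^sub>C (x :: 'a::measured L2)"
  by transfer (auto simp: L2_rel_def mult.assoc intro: square_integrable_scale)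

lemma scaleC_of_real: "complex_of_real r *\<^sub>C x = r *\<^sub>R (x :: 'a::measured L2)"
  by (simp add: scaleR_L2_def)

lemma scaleC_minus_left: "(- c) *\<^sub>C x = - (c *\<^sub>C (x :: 'a::measured L2))"
  by transfer (auto simp: L2_rel_def intro: square_integrable_scale square_integrable_uminus)

lemma scaleC_diff_left: "(c - d) *\<^sub>C x = c *\<^sub>C x - d *\<^sub>C (x :: 'a::measured L2)"
  using scaleC_add_left[of c "- d" x] by (simp add: scaleC_minus_left)

lemma scaleC_diff_right: "c *\<^sub>C (x - y) = c *\<^sub>C x - c *\<^sub>C (y :: 'a::measured L2)"
  using scaleC_add_right[of c "x - y" y] by (simp add: algebra_simps)

lemma cinner_add_right: "cinner x (y + z) = cinner x y + cinner (x :: 'a::measured L2) z"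
  by (metis cinner_add_left cinner_commute complex_cnj_add)

lemma cinner_scaleC_right: "cinner x (c *\<^sub>C y) = cnj c * cinner (x :: 'a::measured L2) y"
  by (metis cinner_commute cinner_scaleC_left complex_cnj_mult)

lemma cinner_diff_left: "cinner (x - y) z = cinner x z - cinner (y :: 'a::measured L2) z"
  using cinner_add_left[of "x - y" y z] by simp

lemma cinner_diff_right: "cinner x (y - z) = cinner x y - cinner (x :: 'a::measured L2) z"
  using cinner_add_right[of x "y - z" z] by simp

lemma cinner_sum_left: "cinner (\<Sum>i\<in>A. f i) y = (\<Sum>i\<in>A. cinner (f i) (y :: 'a::measured L2))"
proof (induction A rule: infinite_finite_induct)
  case (infinite A)
  have "cinner 0 y = 0" using cinner_diff_left[of y y y] by simp
  then show ?case using infinite by simp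
next
  case empty
  have "cinner 0 y = 0" using cinner_diff_left[of y y y] by simp
  then show ?case by simp
qed (simp add: cinner_add_left)

lemma cinner_sum_right: "cinner y (\<Sum>i\<in>A. f i) = (\<Sum>i\<in>A. cinner (y :: 'a::measured L2) (f i))"
  by (subst cinner_commute) (simp add: cinner_sum_left cinner_commute[of y])

lemma cinner_self: "cinner x x = complex_of_real ((norm (x :: 'a::measured L2))\<^sup>2)"
proof -
  have "Im (cinner x x) = - Im (cinner x x)"
    by (metis cinner_commute cnj.simps(2))
  moreover have "Re (cinner x x) = (norm x)\<^sup>2"
    by (simp add: norm_L2_def cinner_self_nonneg)
  ultimately show ?thesis by (simp add: complex_eq_iff)
qed

lemma norm_scaleC: "norm (c *\<^sub>C x) = cmod c * norm (x :: 'a::measured L2)"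
proof -
  have "cinner (c *\<^sub>C x) (c *\<^sub>C x) = (c * cnj c) * cinner x x"
    by (simp add: cinner_scaleC_left cinner_scaleC_right)
  also have "\<dots> = complex_of_real ((cmod c * norm x)\<^sup>2)"
    by (simp only: cinner_self complex_norm_square[symmetric] power_mult_distrib of_real_mult)
  finally have "(norm (c *\<^sub>C x))\<^sup>2 = (cmod c * norm x)\<^sup>2"
    unfolding cinner_self of_real_eq_iff .
  then show ?thesis by (simp add: power2_eq_iff_nonneg)
qed

section \<open>Bessel's inequality and Cauchy-Schwarz\<close>

text \<open>With \<open>y\<close> the orthogonal projection of \<open>x\<close> onto the span of
  \<open>F\<close>, the products of \<open>x\<close> with \<open>y\<close>, \<open>y\<close> with
  \<open>x\<close> and \<open>y\<close> with itself all equal the sum \<open>s\<close>, so 0 \<le>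
  |x - y|^2 = |x|^2 - s.\<close>

lemma bessel_finite:
  fixes x :: "'a::measured L2"
  assumes B: "orthonormal B" and F: "finite F" "F \<subseteq> B"
  shows "(\<Sum>e\<in>F. (cmod (cinner e x))\<^sup>2) \<le> (norm x)\<^sup>2"
proof -
  define y where "y = (\<Sum>e\<in>F. cinner x e *\<^sub>C e)"
  define s where "s = (\<Sum>e\<in>F. (cmod (cinner e x))\<^sup>2)"
  have sq: "cinner x e * cinner e x = complex_of_real ((cmod (cinner e x))\<^sup>2)" for e
    by (subst cinner_commute[of x e]) (simp only: complex_norm_square mult.commute)
  have yx: "cinner y x = complex_of_real s"
    by (simp add: y_def s_def cinner_sum_left cinner_scaleC_left sq)
  have ye: "cinner y e = cinner x e" if "e \<in> F" for e
  proof -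
    have "cinner y e = (\<Sum>e'\<in>F. if e' = e then cinner x e else 0)"
      unfolding y_def cinner_sum_left
      using B F that
      by (intro sum.cong) (auto simp: cinner_scaleC_left orthonormal_def cinner_self)
    then show ?thesis using F that by simp
  qed
  have "cinner y y = (\<Sum>e\<in>F. cnj (cinner x e) * cinner y e)"
    by (subst (2) y_def) (simp add: cinner_sum_right cinner_scaleC_right)
  also have "\<dots> = complex_of_real s"
    unfolding s_def of_real_sum
    by (rule sum.cong[OF refl]) (metis ye sq cinner_commute mult.commute)
  finally have yy: "cinner y y = complex_of_real s" .
  have xy: "cinner x y = complex_of_real s"
    by (subst cinner_commute) (simp add: yx)
  have "0 \<le> Re (cinner (x - y) (x - y))" by (rule cinner_self_nonneg)
  also have "cinner (x - y) (x - y) = complex_of_real ((norm x)\<^sup>2 - s)"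
    by (simp add: cinner_diff_left cinner_diff_right xy yx yy cinner_self[of x])
  finally show ?thesis by (simp add: s_def)
qed

text \<open>The inner product of the type class is only the real part of \<open>cinner\<close>, so
  its Cauchy-Schwarz inequality does not bound the modulus. Bessel's inequality for the single unit
  vector \<open>x / norm x\<close> does.\<close>

lemma cauchy_schwarz_cinner: "cmod (cinner x y) \<le> norm x * norm (y :: 'a::measured L2)"
proof (cases "x = 0")
  case True
  then show ?thesis using cinner_diff_left[of y y y] by simp
next
  case False
  define e where "e = x /\<^sub>R norm x"
  have x: "x = complex_of_real (norm x) *\<^sub>C e"
    using False by (simp add: e_def scaleC_of_real)
  have "orthonormal {e}"
    using False by (simp add: orthonormal_def e_def)
  from bessel_finite[OF this, of "{e}" y]
  have "cmod (cinner e y) \<le> norm y"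
    by (simp add: power2_le_iff_abs_le)
  moreover have "cmod (cinner x y) = norm x * cmod (cinner e y)"
    by (subst x) (simp add: cinner_scaleC_left norm_mult)
  ultimately show ?thesis by (simp add: mult_left_mono)
qed

section \<open>Rank-one operators in the Hilbert-Schmidt class\<close>

lemma bounded_clinear_rank_one: "bounded_clinear (\<lambda>v. c *\<^sub>C rank_one (w :: 'a::measured L2) v)"
  unfolding bounded_clinear_def
proof (intro conjI allI)
  show "bounded_linear (\<lambda>v. c *\<^sub>C rank_one w v)"
  proof (rule bounded_linear_intro)
    show "norm (c *\<^sub>C rank_one w v) \<le> norm v * (cmod c * norm w * norm w)" for v
      using mult_right_mono[OF cauchy_schwarz_cinner[of v w], of "cmod c * norm w"]
      by (simp add: rank_one_def norm_scaleC mult_ac)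
  qed (auto simp: rank_one_def cinner_add_left scaleC_add_left scaleC_add_right cinner_scaleC_left
      scaleC_scaleC scaleC_of_real[symmetric] mult_ac)
qed (auto simp: rank_one_def cinner_scaleC_left scaleC_scaleC mult_ac)

lemma bessel_summable:
  fixes x :: "'a::measured L2"
  assumes "orthonormal B"
  shows "(\<lambda>e. (cmod (cinner e x))\<^sup>2) summable_on B"
  by (rule nonneg_bdd_above_summable_on) (auto intro!: bdd_aboveI2 bessel_finite[OF assms])

lemma hilbert_schmidt_rank_one: "hilbert_schmidt (\<lambda>v. c *\<^sub>C rank_one (w :: 'a::measured L2) v)"
  unfolding hilbert_schmidt_def
proof (intro conjI allI impI bounded_clinear_rank_one)
  fix B :: "'a L2 set" assume "orthonormal_basis B"
  then have "(\<lambda>e. (cmod c * norm w)\<^sup>2 * (cmod (cinner e w))\<^sup>2) summable_on B"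
    by (intro summable_on_cmult_right bessel_summable) (simp add: orthonormal_basis_def)
  then show "(\<lambda>e. (norm (c *\<^sub>C rank_one w e))\<^sup>2) summable_on B"
    by (simp add: rank_one_def norm_scaleC power_mult_distrib mult_ac)
qed

text \<open>The difference is a sum of two rank-one operators, one with the small vector
  \<open>w - w0\<close> in its range and one with the small functional given by \<open>z\<close>.
  Summing over an orthonormal set, Bessel's inequality turns each functional into the norm of its
  vector.\<close>

lemma hs_norm_rank_one_diff:
  fixes w w0 :: "'a::measured L2"
  shows "(hs_norm (\<lambda>v. c *\<^sub>C rank_one w v - c0 *\<^sub>C rank_one w0 v))\<^sup>2 \<le>
    2 * (cmod c * norm w * norm (w - w0))\<^sup>2 + 2 * (norm (cnj c *\<^sub>C w - cnj c0 *\<^sub>C w0) * norm w0)\<^sup>2"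
proof -
  \<comment> \<open>This is literally the basis chosen inside \<open>hs_norm\<close>; only its
    orthonormality enters the estimate.\<close>
  define B :: "'a L2 set" where "B = (SOME B. orthonormal_basis B)"
  have "orthonormal_basis B"
    unfolding B_def using ex_orthonormal_basis by (rule someI_ex)
  then have B: "orthonormal B" by (simp add: orthonormal_basis_def)
  define T where "T = (\<lambda>v. c *\<^sub>C rank_one w v - c0 *\<^sub>C rank_one w0 v)"
  define z where "z = cnj c *\<^sub>C w - cnj c0 *\<^sub>C w0"
  define K where "K = 2 * (cmod c * norm w * norm (w - w0))\<^sup>2 + 2 * (norm z * norm w0)\<^sup>2"
  have T: "T v = (c * cinner v w) *\<^sub>C (w - w0) + cinner v z *\<^sub>C w0" for v
    by (simp add: T_def z_def rank_one_def scaleC_diff_left scaleC_diff_right scaleC_scaleC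
        cinner_diff_right cinner_scaleC_right)
  have Tb: "(norm (T v))\<^sup>2 \<le> 2 * (cmod c * norm (w - w0))\<^sup>2 * (cmod (cinner v w))\<^sup>2
      + 2 * (norm w0)\<^sup>2 * (cmod (cinner v z))\<^sup>2" for v
  proof -
    have "norm (T v) \<le> cmod c * norm (w - w0) * cmod (cinner v w) + norm w0 * cmod (cinner v z)"
      unfolding T by (rule order_trans[OF norm_triangle_ineq]) (simp add: norm_scaleC norm_mult mult_ac)
    then have "(norm (T v))\<^sup>2 \<le>
        (cmod c * norm (w - w0) * cmod (cinner v w) + norm w0 * cmod (cinner v z))\<^sup>2"
      by (rule power_mono) simp
    also have "\<dots> \<le> 2 * (cmod c * norm (w - w0) * cmod (cinner v w))\<^sup>2 + 2 * (norm w0 * cmod (cinner v z))\<^sup>2"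
      using sum_squares_bound[of "cmod c * norm (w - w0) * cmod (cinner v w)" "norm w0 * cmod (cinner v z)"]
      by (simp add: power2_sum)
    finally show ?thesis by (simp add: power_mult_distrib)
  qed
  have fin: "(\<Sum>e\<in>F. (norm (T e))\<^sup>2) \<le> K" if "finite F" "F \<subseteq> B" for F
  proof -
    have "(\<Sum>e\<in>F. (norm (T e))\<^sup>2) \<le> 2 * (cmod c * norm (w - w0))\<^sup>2 * (\<Sum>e\<in>F. (cmod (cinner e w))\<^sup>2)
        + 2 * (norm w0)\<^sup>2 * (\<Sum>e\<in>F. (cmod (cinner e z))\<^sup>2)"
      unfolding sum_distrib_left sum.distrib[symmetric] by (intro sum_mono Tb)
    also have "\<dots> \<le> 2 * (cmod c * norm (w - w0))\<^sup>2 * (norm w)\<^sup>2 + 2 * (norm w0)\<^sup>2 * (norm z)\<^sup>2"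
      by (intro add_mono mult_left_mono bessel_finite[OF B that]) auto
    also have "\<dots> = K" by (simp add: K_def power_mult_distrib)
    finally show ?thesis .
  qed
  have "(\<lambda>e. (norm (T e))\<^sup>2) summable_on B"
    by (rule nonneg_bdd_above_summable_on) (auto intro!: bdd_aboveI2 fin)
  then have "(\<Sum>\<^sub>\<infinity>e\<in>B. (norm (T e))\<^sup>2) \<le> K"
    by (rule infsum_le_finite_sums) (rule fin)
  moreover have "(hs_norm T)\<^sup>2 = (\<Sum>\<^sub>\<infinity>e\<in>B. (norm (T e))\<^sup>2)"
    by (simp add: hs_norm_def B_def infsum_nonneg)
  ultimately show ?thesis by (simp add: T_def K_def z_def)
qed

text \<open>Reduces Hilbert-Schmidt convergence to convergence of a scalar and a vector: both terms
  of the preceding bound contain a factor tending to 0.\<close>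

lemma tendsto_hs_rank_one:
  fixes w :: "'b \<Rightarrow> 'a::measured L2"
  assumes c: "(c \<longlongrightarrow> c0) F" and w: "(w \<longlongrightarrow> w0) F"
  shows "tendsto_hs (\<lambda>x v. c x *\<^sub>C rank_one (w x) v) (\<lambda>v. c0 *\<^sub>C rank_one w0 v) F"
proof -
  define N where "N = (\<lambda>x. hs_norm (\<lambda>v. c x *\<^sub>C rank_one (w x) v - c0 *\<^sub>C rank_one w0 v))"
  have z: "((\<lambda>x. norm (cnj (c x) *\<^sub>C w x - cnj c0 *\<^sub>C w0)) \<longlongrightarrow> 0) F"
  proof (rule tendsto_sandwich[OF _ _ tendsto_const])
    show "\<forall>\<^sub>F x in F. norm (cnj (c x) *\<^sub>C w x - cnj c0 *\<^sub>C w0) \<le>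
        cmod (c x) * norm (w x - w0) + cmod (c x - c0) * norm w0"
    proof (intro always_eventually allI)
      fix x
      have "cnj (c x) *\<^sub>C w x - cnj c0 *\<^sub>C w0 = cnj (c x) *\<^sub>C (w x - w0) + cnj (c x - c0) *\<^sub>C w0"
        by (simp add: scaleC_diff_left scaleC_diff_right)
      then show "norm (cnj (c x) *\<^sub>C w x - cnj c0 *\<^sub>C w0) \<le>
        cmod (c x) * norm (w x - w0) + cmod (c x - c0) * norm w0"
        using norm_triangle_ineq[of "cnj (c x) *\<^sub>C (w x - w0)" "cnj (c x - c0) *\<^sub>C w0"]
        by (simp only: norm_scaleC complex_mod_cnj)
    qed
    have "((\<lambda>x. cmod (c x) * norm (w x - w0) + cmod (c x - c0) * norm w0) \<longlongrightarrow>
        cmod c0 * norm (w0 - w0) + cmod (c0 - c0) * norm w0) F"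
      by (intro tendsto_intros c w)
    then show "((\<lambda>x. cmod (c x) * norm (w x - w0) + cmod (c x - c0) * norm w0) \<longlongrightarrow> 0) F"
      by simp
  qed auto
  have "((\<lambda>x. (N x)\<^sup>2) \<longlongrightarrow> 0) F"
  proof (rule tendsto_sandwich[OF _ _ tendsto_const])
    show "\<forall>\<^sub>F x in F. (N x)\<^sup>2 \<le> 2 * (cmod (c x) * norm (w x) * norm (w x - w0))\<^sup>2 +
        2 * (norm (cnj (c x) *\<^sub>C w x - cnj c0 *\<^sub>C w0) * norm w0)\<^sup>2"
      unfolding N_def by (intro always_eventually allI hs_norm_rank_one_diff)
    have "((\<lambda>x. 2 * (cmod (c x) * norm (w x) * norm (w x - w0))\<^sup>2 +
        2 * (norm (cnj (c x) *\<^sub>C w x - cnj c0 *\<^sub>C w0) * norm w0)\<^sup>2) \<longlongrightarrow>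
        2 * (cmod c0 * norm w0 * norm (w0 - w0))\<^sup>2 + 2 * (0 * norm w0)\<^sup>2) F"
      by (intro tendsto_intros c w z)
    then show "((\<lambda>x. 2 * (cmod (c x) * norm (w x) * norm (w x - w0))\<^sup>2 +
        2 * (norm (cnj (c x) *\<^sub>C w x - cnj c0 *\<^sub>C w0) * norm w0)\<^sup>2) \<longlongrightarrow> 0) F"
      by simp
  qed auto
  then have "(N \<longlongrightarrow> 0) F"
    using tendsto_real_sqrt[of "\<lambda>x. (N x)\<^sup>2" 0 F] tendsto_rabs_zero_iff[of N F] by simp
  then show ?thesis
    by (auto simp: tendsto_hs_def N_def hilbert_schmidt_rank_one)
qed

text \<open>\<open>w\<close> enters twice, hence the square. This is the source of the factor that
  cancels the quadratic zero of \<open>G\<close> at the resonance.\<close>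

lemma rank_one_scaleR: "rank_one (r *\<^sub>R w) v = complex_of_real (r\<^sup>2) *\<^sub>C rank_one w v"
  by (simp add: rank_one_def scaleR_L2_def cinner_scaleC_right scaleC_scaleC power2_eq_square mult_ac)

lemma tendsto_hs_cong:
  assumes "tendsto_hs T T0 F" "\<forall>\<^sub>F x in F. T x = T' x"
  shows "tendsto_hs T' T0 F"
  unfolding tendsto_hs_def
proof (intro conjI)
  show "hilbert_schmidt T0" using assms by (simp add: tendsto_hs_def)
  have "\<forall>\<^sub>F x in F. hilbert_schmidt (T x)" using assms by (simp add: tendsto_hs_def)
  with assms(2) show "\<forall>\<^sub>F x in F. hilbert_schmidt (T' x)" by eventually_elim simp
  have "((\<lambda>x. hs_norm (\<lambda>v. T x v - T0 v)) \<longlongrightarrow> 0) F" using assms by (simp add: tendsto_hs_def)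
  moreover have "\<forall>\<^sub>F x in F. hs_norm (\<lambda>v. T x v - T0 v) = hs_norm (\<lambda>v. T' x v - T0 v)"
    using assms(2) by eventually_elim simp
  ultimately show "((\<lambda>x. hs_norm (\<lambda>v. T' x v - T0 v)) \<longlongrightarrow> 0) F"
    by (rule Lim_transform_eventually)
qed

subsection \<open>Principal value integrals\<close>

text \<open>Dominated convergence for a continuous parameter, obtained by testing along sequences.
  Since domination holds only eventually, an initial segment of each sequence is dropped. It serves
  both cutoffs tending to 0 and base points tending to \<open>l0\<close>.\<close>

lemma tendsto_integral_dominated:
  fixes s :: "'b::first_countable_topology \<Rightarrow> 'a \<Rightarrow> 'c::{banach, second_countable_topology}"
  assumes meas: "f \<in> borel_measurable M" "\<And>t. s t \<in> borel_measurable M"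
    and w: "integrable M w"
    and bound: "\<forall>\<^sub>F t in at a within A. AE x in M. norm (s t x) \<le> w x"
    and lim: "AE x in M. ((\<lambda>t. s t x) \<longlongrightarrow> f x) (at a within A)"
  shows "((\<lambda>t. integral\<^sup>L M (s t)) \<longlongrightarrow> integral\<^sup>L M f) (at a within A)"
  unfolding tendsto_at_iff_sequentially
proof (intro allI impI)
  fix X assume X: "\<forall>i. X i \<in> A - {a}" "X \<longlonglongrightarrow> a"
  then have F: "filterlim X (at a within A) sequentially"
    by (auto simp: filterlim_at)
  obtain N where N: "\<And>n. n \<ge> N \<Longrightarrow> AE x in M. norm (s (X n) x) \<le> w x"
    using eventually_compose_filterlim[OF bound F] by (auto simp: eventually_sequentially)
  have "(\<lambda>n. integral\<^sup>L M (s (X (n + N)))) \<longlonglongrightarrow> integral\<^sup>L M f"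
  proof (rule integral_dominated_convergence[where w = w])
    show "AE x in M. (\<lambda>n. s (X (n + N)) x) \<longlonglongrightarrow> f x"
      using lim
    proof eventually_elim
      case (elim x)
      then show ?case
        using LIMSEQ_ignore_initial_segment[OF filterlim_compose[OF elim F], of N] by simp
    qed
    show "AE x in M. norm (s (X (n + N)) x) \<le> w x" for n
      using N[of "n + N"] by simp
  qed (use meas w in auto)
  then show "((\<lambda>t. integral\<^sup>L M (s t)) \<circ> X) \<longlonglongrightarrow> integral\<^sup>L M f"
    using LIMSEQ_offset by (auto simp: o_def)
qed

text \<open>The principal value of \<open>q x / (x - l)\<close>, written as absolutely convergent integrals: the kernel
  is odd, so \<open>q l\<close> may be subtracted on the interval of radius \<open>r\<close> around \<open>l\<close>.\<close>

definition pv_split :: "(real \<Rightarrow> real) \<Rightarrow> real \<Rightarrow> real \<Rightarrow> real" where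
  "pv_split q r l =
     (\<integral>t. (if \<bar>t\<bar> \<le> r then (q (l + t) - q l) / t else 0) \<partial>lborel) +
     (\<integral>x. (if r < \<bar>x - l\<bar> then q x / (x - l) else 0) \<partial>lborel)"

lemma integrable_const_interval:
  "integrable lborel (\<lambda>t::real. if \<bar>t\<bar> \<le> r then c else (0::real))"
proof -
  have "integrable lborel (\<lambda>t::real. indicator {-r..r} t *\<^sub>R c)"
    by (intro integrable_scaleR_left integrable_real_indicator)
       (simp_all add: emeasure_lborel_Icc_eq)
  also have "(\<lambda>t::real. indicator {-r..r} t *\<^sub>R c) = (\<lambda>t. if \<bar>t\<bar> \<le> r then c else 0)"
    by (auto simp: fun_eq_iff indicator_def)
  finally show ?thesis .
qed

text \<open>The integrand is odd, so reflection makes the integral its own negative. If \<epsilon>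
  \<le> 0 makes the integrand non-integrable, the value is the default 0.\<close>

lemma integral_truncated_inverse:
  "(\<integral>t. (if \<epsilon> \<le> \<bar>t\<bar> \<and> \<bar>t\<bar> \<le> r then c / t else 0) \<partial>lborel) = (0::real)"
  (is "integral\<^sup>L lborel ?f = 0")
proof -
  have "integral\<^sup>L lborel ?f = (\<integral>t. ?f (0 + (-1) * t) \<partial>lborel)"
    by (subst lborel_integral_real_affine[of "-1" _ 0]) auto
  also have "\<dots> = (\<integral>t. - ?f t \<partial>lborel)"
    by (rule Bochner_Integration.integral_cong) auto
  finally show ?thesis by simp
qed

lemma integrable_cut_inverse:
  fixes q :: "real \<Rightarrow> real"
  assumes q: "integrable lborel q" and "\<epsilon> > 0"
    and [measurable]: "Measurable.pred lborel P" and P: "\<And>x. P x \<Longrightarrow> \<epsilon> \<le> \<bar>x - l\<bar>"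
  shows "integrable lborel (\<lambda>x. if P x then q x / (x - l) else 0)"
proof (rule Bochner_Integration.integrable_bound)
  show "integrable lborel (\<lambda>x. \<bar>q x\<bar> / \<epsilon>)" using q by auto
  have [measurable]: "q \<in> borel_measurable borel" using q by auto
  show "(\<lambda>x. if P x then q x / (x - l) else 0) \<in> borel_measurable lborel" by measurable
  have "\<bar>q x\<bar> / \<bar>x - l\<bar> \<le> \<bar>q x\<bar> / \<epsilon>" if "P x" for x
    using P[OF that] \<open>\<epsilon> > 0\<close> by (intro divide_left_mono) auto
  then show "AE x in lborel. norm (if P x then q x / (x - l) else 0) \<le> norm (\<bar>q x\<bar> / \<epsilon>)"
    using \<open>\<epsilon> > 0\<close> by (intro AE_I2) (auto simp: abs_divide)
qed

text \<open>The absolute value of \<open>L\<close> is taken because the hypothesis says nothing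
  about its sign when t = 0, where the quotient is 0 by convention.\<close>

lemma lipschitz_quotient_bound:
  fixes q :: "real \<Rightarrow> real"
  assumes "\<bar>q (l + t) - q l\<bar> \<le> L * \<bar>t\<bar>"
  shows "\<bar>(q (l + t) - q l) / t\<bar> \<le> \<bar>L\<bar>"
proof (cases "t = 0")
  case False
  have "L * \<bar>t\<bar> \<le> \<bar>L\<bar> * \<bar>t\<bar>" by (intro mult_right_mono) auto
  with assms have "\<bar>q (l + t) - q l\<bar> \<le> \<bar>L\<bar> * \<bar>t\<bar>" by (rule order_trans)
  then show ?thesis using False by (simp add: abs_divide divide_le_eq)
qed simp

text \<open>For \<epsilon> < r the part outside radius \<open>r\<close> does not depend on
  \<epsilon>. On the annulus, \<open>q l\<close> may be subtracted by oddness of the kernel, and the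
  remaining difference quotient is bounded by the Lipschitz constant, so dominated convergence
  applies.\<close>

lemma pv_split_tendsto:
  fixes q :: "real \<Rightarrow> real"
  assumes q: "integrable lborel q" and r: "r > 0"
    and lip: "\<And>t. \<bar>t\<bar> \<le> r \<Longrightarrow> \<bar>q (l + t) - q l\<bar> \<le> L * \<bar>t\<bar>"
  shows "((\<lambda>\<epsilon>. \<integral>x. (if \<epsilon> \<le> \<bar>x - l\<bar> then q x / (x - l) else 0) \<partial>lborel) \<longlongrightarrow> pv_split q r l)
           (at_right 0)"
proof -
  have [measurable]: "q \<in> borel_measurable borel" using q by auto
  define near where "near = (\<lambda>\<epsilon> t. if \<epsilon> \<le> \<bar>t\<bar> \<and> \<bar>t\<bar> \<le> r then (q (l + t) - q l) / t else 0)"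
  have near_bound: "norm (near \<epsilon> t) \<le> (if \<bar>t\<bar> \<le> r then \<bar>L\<bar> else 0)" for \<epsilon> t
    using lipschitz_quotient_bound[OF lip] by (auto simp: near_def)
  have near_int: "integrable lborel (near \<epsilon>)" for \<epsilon>
    by (rule Bochner_Integration.integrable_bound[OF integrable_const_interval[of r "\<bar>L\<bar>"]])
       (use near_bound in \<open>auto simp: near_def[abs_def]\<close>)
  have "((\<lambda>\<epsilon>. integral\<^sup>L lborel (near \<epsilon>)) \<longlongrightarrow>
      (\<integral>t. (if \<bar>t\<bar> \<le> r then (q (l + t) - q l) / t else 0) \<partial>lborel)) (at_right 0)"
  proof (rule tendsto_integral_dominated[OF _ _ integrable_const_interval])
    show "\<forall>\<^sub>F \<epsilon> in at_right 0. AE t in lborel. norm (near \<epsilon> t) \<le> (if \<bar>t\<bar> \<le> r then \<bar>L\<bar> else 0)"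
      using near_bound by auto
    show "AE t in lborel.
        ((\<lambda>\<epsilon>. near \<epsilon> t) \<longlongrightarrow> (if \<bar>t\<bar> \<le> r then (q (l + t) - q l) / t else 0)) (at_right 0)"
    proof (intro AE_I2 tendsto_eventually)
      fix t :: real
      show "\<forall>\<^sub>F \<epsilon> in at_right 0. near \<epsilon> t = (if \<bar>t\<bar> \<le> r then (q (l + t) - q l) / t else 0)"
      \<comment> \<open>For t \<noteq> 0 the cutoff is inactive once \<epsilon> < |t|; at t = 0 both
        sides are 0 because division by zero gives 0.\<close>
      proof (cases "t = 0")
        case False
        then have "\<forall>\<^sub>F \<epsilon> in at_right 0. \<epsilon> < \<bar>t\<bar>"
          by (intro eventually_at_right_less order_tendstoD(2)[OF tendsto_ident_at]) auto
        then show ?thesis by eventually_elim (auto simp: near_def)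
      qed (auto simp: near_def)
    qed
  qed (auto simp: near_def[abs_def])
  then have "((\<lambda>\<epsilon>. integral\<^sup>L lborel (near \<epsilon>) +
      (\<integral>x. (if r < \<bar>x - l\<bar> then q x / (x - l) else 0) \<partial>lborel)) \<longlongrightarrow> pv_split q r l) (at_right 0)"
    unfolding pv_split_def by (intro tendsto_intros)
  moreover have "\<forall>\<^sub>F \<epsilon> in at_right 0. integral\<^sup>L lborel (near \<epsilon>) +
      (\<integral>x. (if r < \<bar>x - l\<bar> then q x / (x - l) else 0) \<partial>lborel) =
      (\<integral>x. (if \<epsilon> \<le> \<bar>x - l\<bar> then q x / (x - l) else 0) \<partial>lborel)"
    using eventually_at_right_less[of 0] order_tendstoD(2)[OF tendsto_ident_at r]
  proof eventually_elim
    case (elim \<epsilon>)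
    let ?in = "\<lambda>x. if \<epsilon> \<le> \<bar>x - l\<bar> \<and> \<bar>x - l\<bar> \<le> r then q x / (x - l) else 0"
    let ?out = "\<lambda>x. if r < \<bar>x - l\<bar> then q x / (x - l) else 0"
    have i1: "integrable lborel ?in"
      by (rule integrable_cut_inverse[OF q \<open>0 < \<epsilon>\<close>]) auto
    have i2: "integrable lborel ?out"
      by (rule integrable_cut_inverse[OF q r]) auto
    have i3: "integrable lborel (\<lambda>t. if \<epsilon> \<le> \<bar>t\<bar> \<and> \<bar>t\<bar> \<le> r then q l / t else 0)"
    proof (rule Bochner_Integration.integrable_bound[OF integrable_const_interval[of r "\<bar>q l\<bar> / \<epsilon>"]])
      have "\<bar>q l\<bar> / \<bar>t\<bar> \<le> \<bar>q l\<bar> / \<epsilon>" if "\<epsilon> \<le> \<bar>t\<bar>" for t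
        using that elim by (intro divide_left_mono) auto
      then show "AE t in lborel. norm (if \<epsilon> \<le> \<bar>t\<bar> \<and> \<bar>t\<bar> \<le> r then q l / t else 0)
          \<le> norm (if \<bar>t\<bar> \<le> r then \<bar>q l\<bar> / \<epsilon> else 0)"
        using elim by (intro AE_I2) (auto simp: abs_divide)
    qed auto
    \<comment> \<open>Translating the annulus to the origin splits the integrand into the difference
      quotient and \<open>q l / t\<close>, whose integral vanishes.\<close>
    have "integral\<^sup>L lborel ?in = (\<integral>t. ?in (l + 1 * t) \<partial>lborel)"
      by (subst lborel_integral_real_affine[of 1 _ l]) auto
    also have "\<dots> = (\<integral>t. near \<epsilon> t + (if \<epsilon> \<le> \<bar>t\<bar> \<and> \<bar>t\<bar> \<le> r then q l / t else 0) \<partial>lborel)"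
      by (rule Bochner_Integration.integral_cong) (auto simp: near_def diff_divide_distrib)
    also have "\<dots> = integral\<^sup>L lborel (near \<epsilon>)"
      by (subst Bochner_Integration.integral_add[OF near_int i3]) (simp add: integral_truncated_inverse)
    finally have "integral\<^sup>L lborel (near \<epsilon>) + integral\<^sup>L lborel ?out = (\<integral>x. ?in x + ?out x \<partial>lborel)"
      using i1 i2 by simp
    also have "\<dots> = (\<integral>x. (if \<epsilon> \<le> \<bar>x - l\<bar> then q x / (x - l) else 0) \<partial>lborel)"
      using elim by (intro Bochner_Integration.integral_cong) auto
    finally show ?case .
  qed
  ultimately show ?thesis
    by (rule Lim_transform_eventually)
qed

text \<open>With \<open>r\<close> fixed, both integrals have majorants independent of
  \<open>l\<close> near \<open>l0\<close>: the constant \<open>\<bar>L\<bar>\<close> on the inner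
  interval and \<open>\<bar>q x\<bar> / r\<close> outside. The Lipschitz condition is on radius
  \<open>2 * r\<close> so that it covers l + t for |l - l0| < r and |t| \<le> r.\<close>

lemma isCont_pv_split:
  fixes q :: "real \<Rightarrow> real"
  assumes q: "integrable lborel q" and r: "r > 0"
    and lip: "\<And>x y. x \<in> cball l0 (2 * r) \<Longrightarrow> y \<in> cball l0 (2 * r) \<Longrightarrow> \<bar>q x - q y\<bar> \<le> L * \<bar>x - y\<bar>"
  shows "isCont (pv_split q r) l0"
proof -
  have [measurable]: "q \<in> borel_measurable borel" using q by auto
  have close: "\<forall>\<^sub>F l in at l0. \<bar>l - l0\<bar> < d" if "d > 0" for d
    using that by (auto simp: eventually_at dist_real_def)
  have cont_q: "q \<midarrow>x\<rightarrow> q x" if "x \<in> ball l0 (2 * r)" for x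
  proof -
    have "L-lipschitz_on (ball l0 (2 * r)) q" if "L \<ge> 0"
      using lip that by (auto simp: lipschitz_on_def dist_real_def)
    moreover have "L \<ge> 0"
      using lip[of l0 "l0 + r"] r by (auto simp: dist_real_def) (smt (verit) mult_neg_pos)
    ultimately have "continuous_on (ball l0 (2 * r)) q"
      by (blast intro: lipschitz_on_continuous_on)
    then show ?thesis
      using that by (simp add: continuous_on_eq_continuous_at isCont_def)
  qed
  have "((\<lambda>l. \<integral>t. (if \<bar>t\<bar> \<le> r then (q (l + t) - q l) / t else 0) \<partial>lborel) \<longlongrightarrow>
      (\<integral>t. (if \<bar>t\<bar> \<le> r then (q (l0 + t) - q l0) / t else 0) \<partial>lborel)) (at l0)"
  proof (rule tendsto_integral_dominated[OF _ _ integrable_const_interval])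
    show "\<forall>\<^sub>F l in at l0. AE t in lborel.
        norm (if \<bar>t\<bar> \<le> r then (q (l + t) - q l) / t else 0) \<le> (if \<bar>t\<bar> \<le> r then \<bar>L\<bar> else 0)"
      using close[OF r]
    proof eventually_elim
      case (elim l)
      have "\<bar>q (l + t) - q l\<bar> \<le> L * \<bar>t\<bar>" if "\<bar>t\<bar> \<le> r" for t
        using lip[of "l + t" l] elim that by (auto simp: dist_real_def)
      then show ?case
        using lipschitz_quotient_bound[of q l _ L] by (intro AE_I2) auto
    qed
    show "AE t in lborel. ((\<lambda>l. if \<bar>t\<bar> \<le> r then (q (l + t) - q l) / t else 0) \<longlongrightarrow>
        (if \<bar>t\<bar> \<le> r then (q (l0 + t) - q l0) / t else 0)) (at l0)"
    proof (intro AE_I2)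
      fix t :: real
      have "((\<lambda>l. (q (l + t) - q l) / t) \<longlongrightarrow> (q (l0 + t) - q l0) / t) (at l0)" if "\<bar>t\<bar> \<le> r"
      proof (cases "t = 0")
        case False
        have "isCont q (l0 + t)"
          using that r cont_q[of "l0 + t"] by (auto simp: dist_real_def isCont_def)
        then have "isCont (\<lambda>l. q (l + t)) l0"
          by (intro isCont_o2[where g = q and f = "\<lambda>l. l + t"]) (auto intro!: continuous_intros)
        then show ?thesis
          using False cont_q[of l0] r by (intro tendsto_intros) (auto simp: isCont_def)
      qed simp
      then show "((\<lambda>l. if \<bar>t\<bar> \<le> r then (q (l + t) - q l) / t else 0) \<longlongrightarrow>
        (if \<bar>t\<bar> \<le> r then (q (l0 + t) - q l0) / t else 0)) (at l0)"
        by auto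
    qed
  qed auto
  moreover have "((\<lambda>l. \<integral>x. (if r < \<bar>x - l\<bar> then q x / (x - l) else 0) \<partial>lborel) \<longlongrightarrow>
      (\<integral>x. (if r < \<bar>x - l0\<bar> then q x / (x - l0) else 0) \<partial>lborel)) (at l0)"
  proof (rule tendsto_integral_dominated)
    show "integrable lborel (\<lambda>x. \<bar>q x\<bar> / r)" using q by auto
    have "\<bar>q x\<bar> / \<bar>x - l\<bar> \<le> \<bar>q x\<bar> / r" if "r < \<bar>x - l\<bar>" for x l
      using that r by (intro divide_left_mono) auto
    then show "\<forall>\<^sub>F l in at l0. AE x in lborel.
        norm (if r < \<bar>x - l\<bar> then q x / (x - l) else 0) \<le> \<bar>q x\<bar> / r"
      using r by (intro always_eventually allI AE_I2) (auto simp: abs_divide)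
    \<comment> \<open>The outer cutoff jumps at l = l0 only for these two values of
      \<open>x\<close>, a null set.\<close>
    have "AE x in lborel. x \<noteq> l0 - r" "AE x in lborel. x \<noteq> l0 + r"
      by (auto intro: AE_lborel_singleton)
    then show "AE x in lborel. ((\<lambda>l. if r < \<bar>x - l\<bar> then q x / (x - l) else 0) \<longlongrightarrow>
        (if r < \<bar>x - l0\<bar> then q x / (x - l0) else 0)) (at l0)"
    proof eventually_elim
      case (elim x)
      then have ne: "\<bar>x - l0\<bar> \<noteq> r" by (auto simp: abs_if split: if_splits)
      have t: "((\<lambda>l. \<bar>x - l\<bar>) \<longlongrightarrow> \<bar>x - l0\<bar>) (at l0)" by (intro tendsto_intros)
      show ?case
      proof (cases "r < \<bar>x - l0\<bar>")
        case True
        have "((\<lambda>l. q x / (x - l)) \<longlongrightarrow> q x / (x - l0)) (at l0)"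
          using True r by (intro tendsto_intros) auto
        moreover have "\<forall>\<^sub>F l in at l0. q x / (x - l) = (if r < \<bar>x - l\<bar> then q x / (x - l) else 0)"
          using order_tendstoD(1)[OF t True] by eventually_elim auto
        ultimately show ?thesis using True by (simp add: Lim_transform_eventually)
      next
        case False
        then have "\<bar>x - l0\<bar> < r" using ne by auto
        from order_tendstoD(2)[OF t this]
        have "\<forall>\<^sub>F l in at l0. (if r < \<bar>x - l\<bar> then q x / (x - l) else 0) = 0"
          by eventually_elim auto
        then show ?thesis using False by (simp add: tendsto_eventually)
      qed
    qed
  qed auto
  ultimately show ?thesis
    unfolding isCont_def pv_split_def[abs_def] by (rule tendsto_add)
qed

text \<open>Polynomial division: (x - l0)^2 / (x - l) = (x - l0) + (l - l0) + (l - l0)^2 / (x - l).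
  The first two terms are absolutely integrable against \<open>q\<close>, and only the last one
  needs a principal value.\<close>

lemma pv_integral_quadratic:
  fixes q :: "real \<Rightarrow> real"
  assumes q: "integrable lborel q" and xq: "integrable lborel (\<lambda>x. x * q x)" and r: "r > 0"
    and lip: "\<And>t. \<bar>t\<bar> \<le> r \<Longrightarrow> \<bar>q (l + t) - q l\<bar> \<le> L * \<bar>t\<bar>"
  shows "pv_integral (\<lambda>x. complex_of_real ((x - l0)\<^sup>2 * q x)) l = complex_of_real
     ((\<integral>x. (x - l0) * q x \<partial>lborel) + (l - l0) * (\<integral>x. q x \<partial>lborel) + (l - l0)\<^sup>2 * pv_split q r l)"
proof -
  have [measurable]: "q \<in> borel_measurable borel" using q by auto
  let ?p = "\<lambda>x. (x - l0) * q x + (l - l0) * q x"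
  have p0: "integrable lborel (\<lambda>x. (x - l0) * q x)"
    using q xq by (simp add: left_diff_distrib)
  then have p: "integrable lborel ?p"
    using q by auto
  have eq: "(LINT x:{x. \<epsilon> \<le> \<bar>x - l\<bar>}|lborel.
        complex_of_real ((x - l0)\<^sup>2 * q x) / complex_of_real (x - l)) =
      complex_of_real ((\<integral>x. (if \<epsilon> \<le> \<bar>x - l\<bar> then ?p x else 0) \<partial>lborel) +
        (l - l0)\<^sup>2 * (\<integral>x. (if \<epsilon> \<le> \<bar>x - l\<bar> then q x / (x - l) else 0) \<partial>lborel))"
    if "\<epsilon> > 0" for \<epsilon>
  proof -
    have i: "integrable lborel (\<lambda>x. if \<epsilon> \<le> \<bar>x - l\<bar> then ?p x else 0)"
      by (rule Bochner_Integration.integrable_bound[OF p]) auto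
    have j: "integrable lborel (\<lambda>x. (l - l0)\<^sup>2 * (if \<epsilon> \<le> \<bar>x - l\<bar> then q x / (x - l) else 0))"
      by (intro integrable_mult_right integrable_cut_inverse[OF q that]) auto
    have alg: "(x - l0)\<^sup>2 * q x / (x - l) = ?p x + (l - l0)\<^sup>2 * (q x / (x - l))" if "x \<noteq> l" for x
      using that by (simp add: field_simps power2_eq_square)
    have "(LINT x:{x. \<epsilon> \<le> \<bar>x - l\<bar>}|lborel.
        complex_of_real ((x - l0)\<^sup>2 * q x) / complex_of_real (x - l)) =
        complex_of_real (LINT x:{x. \<epsilon> \<le> \<bar>x - l\<bar>}|lborel. (x - l0)\<^sup>2 * q x / (x - l))"
      by (simp only: of_real_divide [symmetric] set_integral_complex_of_real)
    also have "(LINT x:{x. \<epsilon> \<le> \<bar>x - l\<bar>}|lborel. (x - l0)\<^sup>2 * q x / (x - l)) =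
        (\<integral>x. (if \<epsilon> \<le> \<bar>x - l\<bar> then ?p x else 0) +
             (l - l0)\<^sup>2 * (if \<epsilon> \<le> \<bar>x - l\<bar> then q x / (x - l) else 0) \<partial>lborel)"
      unfolding set_lebesgue_integral_def
    proof (rule Bochner_Integration.integral_cong)
      fix x
      show "indicator {x. \<epsilon> \<le> \<bar>x - l\<bar>} x *\<^sub>R ((x - l0)\<^sup>2 * q x / (x - l)) =
        (if \<epsilon> \<le> \<bar>x - l\<bar> then ?p x else 0) +
             (l - l0)\<^sup>2 * (if \<epsilon> \<le> \<bar>x - l\<bar> then q x / (x - l) else 0)"
        using alg[of x] that by (auto simp: indicator_def)
    qed simp
    finally show ?thesis
      using Bochner_Integration.integral_add[OF i j] by simp
  qed
  have "((\<lambda>\<epsilon>. \<integral>x. (if \<epsilon> \<le> \<bar>x - l\<bar> then ?p x else 0) \<partial>lborel) \<longlongrightarrow> integral\<^sup>L lborel ?p) (at_right 0)"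
  proof (rule tendsto_integral_dominated)
    show "integrable lborel (\<lambda>x. \<bar>?p x\<bar>)" using p by auto
    show "\<forall>\<^sub>F \<epsilon> in at_right 0. AE x in lborel. norm (if \<epsilon> \<le> \<bar>x - l\<bar> then ?p x else 0) \<le> \<bar>?p x\<bar>"
      by auto
    show "AE x in lborel. ((\<lambda>\<epsilon>. if \<epsilon> \<le> \<bar>x - l\<bar> then ?p x else 0) \<longlongrightarrow> ?p x) (at_right 0)"
      using AE_lborel_singleton[of l]
    proof eventually_elim
      case (elim x)
      then have "\<forall>\<^sub>F \<epsilon> in at_right 0. \<epsilon> < \<bar>x - l\<bar>"
        by (intro order_tendstoD(2)[OF tendsto_ident_at]) auto
      then have "\<forall>\<^sub>F \<epsilon> in at_right 0. (if \<epsilon> \<le> \<bar>x - l\<bar> then ?p x else 0) = ?p x"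
        by eventually_elim auto
      then show ?case by (rule tendsto_eventually)
    qed
  qed auto
  also have "integral\<^sup>L lborel ?p =
      (\<integral>x. (x - l0) * q x \<partial>lborel) + (l - l0) * (\<integral>x. q x \<partial>lborel)"
    using p0 q by simp
  finally have "((\<lambda>\<epsilon>. complex_of_real ((\<integral>x. (if \<epsilon> \<le> \<bar>x - l\<bar> then ?p x else 0) \<partial>lborel) +
        (l - l0)\<^sup>2 * (\<integral>x. (if \<epsilon> \<le> \<bar>x - l\<bar> then q x / (x - l) else 0) \<partial>lborel))) \<longlongrightarrow>
      complex_of_real ((\<integral>x. (x - l0) * q x \<partial>lborel) + (l - l0) * (\<integral>x. q x \<partial>lborel) +
        (l - l0)\<^sup>2 * pv_split q r l)) (at_right 0)"
    by (intro tendsto_intros pv_split_tendsto[OF q r lip])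
  then have "((\<lambda>\<epsilon>. LINT x:{x. \<epsilon> \<le> \<bar>x - l\<bar>}|lborel.
        complex_of_real ((x - l0)\<^sup>2 * q x) / complex_of_real (x - l)) \<longlongrightarrow>
      complex_of_real ((\<integral>x. (x - l0) * q x \<partial>lborel) + (l - l0) * (\<integral>x. q x \<partial>lborel) +
        (l - l0)\<^sup>2 * pv_split q r l)) (at_right 0)"
    by (rule Lim_transform_eventually)
       (use eventually_at_right_less[of 0] in \<open>eventually_elim, simp only: eq\<close>)
  then show ?thesis
    unfolding pv_integral_def by (intro tendsto_Lim) auto
qed

subsection \<open>Fibres vanishing at an interior energy\<close>

text \<open>Mean value inequality, applied below to u', to the first-order Taylor remainder of
  \<open>u\<close>, and to the quotient u / (x - l0) together with the numerator of its
  derivative.\<close>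

lemma norm_diff_le_vector_derivative:
  fixes f :: "real \<Rightarrow> 'a::real_normed_vector"
  assumes "convex S" and der: "\<And>x. x \<in> S \<Longrightarrow> (f has_vector_derivative f' x) (at x)"
    and B: "\<And>x. x \<in> S \<Longrightarrow> norm (f' x) \<le> B" and "x \<in> S" "y \<in> S"
  shows "norm (f x - f y) \<le> B * \<bar>x - y\<bar>"
proof -
  have "onorm (\<lambda>h. h *\<^sub>R f' z) \<le> B" if "z \<in> S" for z
    using mult_right_mono[OF B[OF that] abs_ge_zero] by (intro onorm_le) (simp add: mult.commute)
  then have "norm (f x - f y) \<le> B * norm (x - y)"
    using assms der
    by (intro differentiable_bound[of S f "\<lambda>x h. h *\<^sub>R f' x"])
       (auto simp: has_vector_derivative_def intro: has_derivative_at_withinI)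
  then show ?thesis by simp
qed

lemma strong_deriv_0 [simp]: "strong_deriv 0 u = u"
  by (simp add: strong_deriv_def)

text \<open>\<open>strong_deriv\<close> iterates a choice operator; the differentiability in
  \<open>rapid_smooth\<close> is what makes its values genuine derivatives.\<close>

lemma has_vector_derivative_strong_deriv:
  assumes "u \<in> rapid_smooth" "l > 0"
  shows "(strong_deriv k u has_vector_derivative strong_deriv (Suc k) u l) (at l)"
  using assms by (simp add: strong_deriv_def rapid_smooth_def vector_derivative_works)

lemma rapid_smooth_bounds:
  assumes "u \<in> rapid_smooth"
  obtains C C' where "\<And>l. l > 0 \<Longrightarrow> norm (u l) \<le> C" "\<And>l. l \<ge> 1 \<Longrightarrow> l ^ m * norm (u l) \<le> C'"
proof -
  have bdd: "bdd_above ((\<lambda>l. l ^ m * norm (u l)) ` {1..}) \<and> bdd_above ((\<lambda>l. norm (u l) / l ^ m) ` {0<..1})" for m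
    using conjunct2[OF spec[OF CollectD[OF assms[unfolded rapid_smooth_def]], of 0], THEN spec, of m]
    unfolding strong_deriv_0 .
  obtain A where A: "\<And>l. l \<ge> 1 \<Longrightarrow> norm (u l) \<le> A"
    using bdd[of 0, THEN conjunct1] by (auto simp: bdd_above_def)
  obtain B where B: "\<And>l. 0 < l \<Longrightarrow> l \<le> 1 \<Longrightarrow> norm (u l) \<le> B"
    using bdd[of 0, THEN conjunct2] by (fastforce simp: bdd_above_def)
  obtain C' where C': "\<And>l. l \<ge> 1 \<Longrightarrow> l ^ m * norm (u l) \<le> C'"
    using bdd[of m, THEN conjunct1] by (auto simp: bdd_above_def)
  have "norm (u l) \<le> max A B" if "l > 0" for l
    using A[of l] B[of l] that by (cases "l \<ge> 1") auto
  with C' that show ?thesis by blast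
qed

text \<open>Let \<open>M\<close> bound u'' on the compact ball, which lies in the positive
  half-line. Taylor expansion at \<open>l0\<close> compares \<phi>(x) with \<phi>(l0). On either
  side of \<open>l0\<close>, \<phi>' = ((x - l0) u' - u) / (x - l0)^2 is bounded by \<open>M\<close>
  as well, since the numerator is O((x - l0)^2). Pairs separated by \<open>l0\<close> are compared
  through \<open>l0\<close>.\<close>

lemma eigen_fibre_lipschitz:
  fixes u :: "real \<Rightarrow> 'a::measured L2"
  assumes u: "u \<in> rapid_smooth" and l0: "l0 > 0" and zero: "u l0 = 0"
  obtains M where "M \<ge> 0" "\<And>x y. x \<in> cball l0 (l0 / 2) \<Longrightarrow> y \<in> cball l0 (l0 / 2) \<Longrightarrow>
    norm (eigen_fibre u l0 x - eigen_fibre u l0 y) \<le> M * \<bar>x - y\<bar>"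
proof -
  let ?S = "cball l0 (l0 / 2)"
  let ?u1 = "strong_deriv 1 u" and ?u2 = "strong_deriv 2 u"
  have pos: "x > 0" if "x \<in> ?S" for x
    using that l0 abs_ge_self[of "l0 - x"] by (simp add: dist_real_def)
  have d0: "(u has_vector_derivative ?u1 x) (at x)" if "x > 0" for x
    using has_vector_derivative_strong_deriv[OF u that, of 0] by simp
  have d1: "(?u1 has_vector_derivative ?u2 x) (at x)" if "x > 0" for x
    using has_vector_derivative_strong_deriv[OF u that, of 1] by (simp add: numeral_2_eq_2)
  have "continuous_on ?S ?u2"
    using has_vector_derivative_strong_deriv[OF u pos, of _ 2]
    by (blast intro: continuous_at_imp_continuous_on has_vector_derivative_continuous)
  then have "bounded (?u2 ` ?S)"
    by (intro compact_imp_bounded compact_continuous_image) auto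
  then obtain M where M: "\<And>x. x \<in> ?S \<Longrightarrow> norm (?u2 x) \<le> M"
    unfolding bounded_iff by blast
  have "norm (?u2 l0) \<le> M"
    using l0 by (intro M) simp
  then have M0: "M \<ge> 0"
    using norm_ge_zero order_trans by blast
  have sub: "cball l0 \<bar>x - l0\<bar> \<subseteq> ?S" if "x \<in> ?S" for x
    using that by (auto simp: dist_real_def abs_minus_commute)
  have u1_lip: "norm (?u1 x - ?u1 l0) \<le> M * \<bar>x - l0\<bar>" if "x \<in> ?S" for x
    by (rule norm_diff_le_vector_derivative[of ?S]) (use that d1 pos M l0 in auto)
  have at_l0: "norm (eigen_fibre u l0 x - eigen_fibre u l0 l0) \<le> M * \<bar>x - l0\<bar>"
    if x: "x \<in> ?S" for x
  proof (cases "x = l0")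
    case False
    have "norm ((u x - (x - l0) *\<^sub>R ?u1 l0) - (u l0 - (l0 - l0) *\<^sub>R ?u1 l0)) \<le> (M * \<bar>x - l0\<bar>) * \<bar>x - l0\<bar>"
    \<comment> \<open>The ball shrinks with \<open>x\<close>, so the derivative bound itself carries
      one factor |x - l0| and the remainder is quadratic.\<close>
    proof (rule norm_diff_le_vector_derivative[of "cball l0 \<bar>x - l0\<bar>" _ "\<lambda>y. ?u1 y - ?u1 l0"])
      fix y assume y: "y \<in> cball l0 \<bar>x - l0\<bar>"
      with sub[OF x] have yS: "y \<in> ?S" by blast
      show "((\<lambda>x. u x - (x - l0) *\<^sub>R ?u1 l0) has_vector_derivative ?u1 y - ?u1 l0) (at y)"
        by (auto intro!: derivative_eq_intros d0 pos yS)
      have "M * \<bar>y - l0\<bar> \<le> M * \<bar>x - l0\<bar>"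
        using y M0 by (intro mult_left_mono) (auto simp: dist_real_def)
      with u1_lip[OF yS] show "norm (?u1 y - ?u1 l0) \<le> M * \<bar>x - l0\<bar>" by linarith
    qed (auto simp: dist_real_def)
    moreover have "eigen_fibre u l0 x - eigen_fibre u l0 l0 = (u x - (x - l0) *\<^sub>R ?u1 l0) /\<^sub>R (x - l0)"
      using False by (simp add: eigen_fibre_def scaleR_diff_right)
    ultimately show ?thesis
      using False zero by (simp add: divide_simps mult_ac)
  qed simp
  have side: "norm (eigen_fibre u l0 x - eigen_fibre u l0 y) \<le> M * \<bar>x - y\<bar>"
    if T: "convex T" "T \<subseteq> ?S - {l0}" "x \<in> T" "y \<in> T" for T x y
  proof -
    \<comment> \<open>The numerator of \<phi>'. It vanishes at \<open>l0\<close> and its derivative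
      is (z - l0) u''(z), the u' terms cancelling.\<close>
    let ?\<psi> = "\<lambda>z. (z - l0) *\<^sub>R ?u1 z - u z"
    have \<psi>: "norm (?\<psi> z) \<le> M * \<bar>z - l0\<bar> * \<bar>z - l0\<bar>" if z: "z \<in> ?S" for z
    proof -
      have "norm (?\<psi> z - ?\<psi> l0) \<le> (M * \<bar>z - l0\<bar>) * \<bar>z - l0\<bar>"
      proof (rule norm_diff_le_vector_derivative[of "cball l0 \<bar>z - l0\<bar>" _ "\<lambda>y. (y - l0) *\<^sub>R ?u2 y"])
        fix y assume y: "y \<in> cball l0 \<bar>z - l0\<bar>"
        with sub[OF z] have yS: "y \<in> ?S" by blast
        show "(?\<psi> has_vector_derivative (y - l0) *\<^sub>R ?u2 y) (at y)"
          by (auto intro!: derivative_eq_intros d0 d1[unfolded One_nat_def] pos yS)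
        have "\<bar>y - l0\<bar> * norm (?u2 y) \<le> \<bar>z - l0\<bar> * M"
          using y M[OF yS] by (intro mult_mono) (auto simp: dist_real_def)
        then show "norm ((y - l0) *\<^sub>R ?u2 y) \<le> M * \<bar>z - l0\<bar>" by (simp add: mult.commute)
      qed (auto simp: dist_real_def)
      then show ?thesis using zero by simp
    qed
    have "norm (inverse (x - l0) *\<^sub>R u x - inverse (y - l0) *\<^sub>R u y) \<le> M * \<bar>x - y\<bar>"
    proof (rule norm_diff_le_vector_derivative[of T _ "\<lambda>z. ?\<psi> z /\<^sub>R (z - l0)\<^sup>2"])
      fix z assume "z \<in> T"
      with T have z: "z \<in> ?S" "z \<noteq> l0" by auto
      have "((\<lambda>x. inverse (x - l0)) has_field_derivative - inverse ((z - l0)\<^sup>2)) (at z)"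
        using z by (auto intro!: derivative_eq_intros simp: power2_eq_square)
      from has_vector_derivative_scaleR[OF this d0[OF pos[OF z(1)]]]
      show "((\<lambda>x. inverse (x - l0) *\<^sub>R u x) has_vector_derivative ?\<psi> z /\<^sub>R (z - l0)\<^sup>2) (at z)"
        using z by (simp add: scaleR_diff_right power2_eq_square mult.assoc)
      show "norm (?\<psi> z /\<^sub>R (z - l0)\<^sup>2) \<le> M"
        using \<psi>[OF z(1)] z by (simp add: divide_simps power2_eq_square abs_mult mult_ac)
    qed (use T in auto)
    then show ?thesis
      using T by (auto simp: eigen_fibre_def)
  qed
  have le: "norm (eigen_fibre u l0 x - eigen_fibre u l0 y) \<le> M * \<bar>x - y\<bar>"
    if x: "x \<in> ?S" and y: "y \<in> ?S" and "x \<le> y" for x y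
  proof (cases "x \<le> l0 \<and> l0 \<le> y")
    case True
    have "norm (eigen_fibre u l0 x - eigen_fibre u l0 y) \<le>
        norm (eigen_fibre u l0 x - eigen_fibre u l0 l0) + norm (eigen_fibre u l0 y - eigen_fibre u l0 l0)"
      using dist_triangle2[of "eigen_fibre u l0 x" "eigen_fibre u l0 y" "eigen_fibre u l0 l0"]
      by (simp add: dist_norm)
    also have "\<dots> \<le> M * \<bar>x - l0\<bar> + M * \<bar>y - l0\<bar>"
      by (intro add_mono at_l0 x y)
    also have "\<dots> = M * \<bar>x - y\<bar>"
      using True by (simp add: abs_if algebra_simps)
    finally show ?thesis .
  next
    case False
    have "closed_segment x y \<subseteq> ?S"
      using x y by (intro closed_segment_subset) auto
    moreover have "l0 \<notin> closed_segment x y"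
      using False \<open>x \<le> y\<close> by (simp add: closed_segment_eq_real_ivl)
    ultimately show ?thesis
      by (intro side[of "closed_segment x y"]) auto
  qed
  then have "norm (eigen_fibre u l0 x - eigen_fibre u l0 y) \<le> M * \<bar>x - y\<bar>"
    if "x \<in> ?S" "y \<in> ?S" for x y
    using that le[of x y] le[of y x] by (cases "x \<le> y") (auto simp: norm_minus_commute abs_minus_commute)
  with M0 that show ?thesis by blast
qed

text \<open>Holds at x = \<open>l0\<close> too, where both sides vanish whatever value the fibre has
  there.\<close>

lemma norm_eigen_fibre:
  "norm (eigen_fibre u l0 x) * \<bar>x - l0\<bar> = norm (u x)" if "u l0 = 0"
  using that by (simp add: eigen_fibre_def)

lemma eigen_fibre_scaleR: "(x - l0) *\<^sub>R eigen_fibre u l0 x = u x" if "u l0 = 0"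
  using that by (simp add: eigen_fibre_def)

section \<open>Integrability and regularity of the squared fibre norm\<close>

text \<open>Extension by zero makes this a function on the whole line, matching
  \<open>fibre_inner\<close>, so that the principal value lemmas apply to it directly.\<close>

definition eigen_density :: "(real \<Rightarrow> 'a::measured L2) \<Rightarrow> real \<Rightarrow> real \<Rightarrow> real" where
  "eigen_density u l0 x = (if x > 0 then (norm (eigen_fibre u l0 x))\<^sup>2 else 0)"

lemma fibre_inner_eigen_density:
  assumes "u l0 = 0"
  shows "fibre_inner u u = (\<lambda>x. complex_of_real ((x - l0)\<^sup>2 * eigen_density u l0 x))"
proof
  fix x
  have "(norm (u x))\<^sup>2 = (x - l0)\<^sup>2 * (norm (eigen_fibre u l0 x))\<^sup>2"
    by (simp add: norm_eigen_fibre[of u l0 x, OF assms, symmetric] power_mult_distrib)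
  then show "fibre_inner u u x = complex_of_real ((x - l0)\<^sup>2 * eigen_density u l0 x)"
    by (simp only: fibre_inner_def eigen_density_def cinner_self) simp
qed

lemma isCont_eigen_fibre:
  fixes u :: "real \<Rightarrow> 'a::measured L2"
  assumes u: "u \<in> rapid_smooth" and l0: "l0 > 0" and zero: "u l0 = 0" and x: "x > 0"
  shows "isCont (eigen_fibre u l0) x"
proof (cases "x = l0")
  case True
  obtain M where "M \<ge> 0" "\<And>x y. x \<in> cball l0 (l0 / 2) \<Longrightarrow> y \<in> cball l0 (l0 / 2) \<Longrightarrow>
      norm (eigen_fibre u l0 x - eigen_fibre u l0 y) \<le> M * \<bar>x - y\<bar>"
    using eigen_fibre_lipschitz[OF u l0 zero] by blast
  then have "M-lipschitz_on (ball l0 (l0 / 2)) (eigen_fibre u l0)"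
    by (auto simp: lipschitz_on_def dist_norm)
  then have "continuous_on (ball l0 (l0 / 2)) (eigen_fibre u l0)"
    by (rule lipschitz_on_continuous_on)
  then show ?thesis
    using True l0 by (simp add: continuous_on_eq_continuous_at)
next
  case False
  have "isCont u x"
    using has_vector_derivative_strong_deriv[OF u x, of 0] has_vector_derivative_continuous by auto
  then have cont: "isCont (\<lambda>l. inverse (l - l0) *\<^sub>R u l) x"
    using False by (intro continuous_intros) auto
  have "\<forall>\<^sub>F l in nhds x. inverse (l - l0) *\<^sub>R u l = eigen_fibre u l0 l"
    using t1_space_nhds[OF False] by eventually_elim (simp add: eigen_fibre_def)
  from isCont_cong[OF this] cont show ?thesis by simp
qed

text \<open>The weight 1 + |x| controls the density and its first moment at once. The fibre is
  bounded near \<open>l0\<close> by the Lipschitz estimate and elsewhere because |x - l0| \<ge> l0 /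
  2; for large \<open>x\<close> the decay of \<open>u\<close> gives the rate.\<close>

lemma eigen_density_bound:
  fixes u :: "real \<Rightarrow> 'a::measured L2"
  assumes u: "u \<in> rapid_smooth" and l0: "l0 > 0" and zero: "u l0 = 0"
  obtains K where "\<And>x. (1 + \<bar>x\<bar>) * eigen_density u l0 x \<le> K * inverse (1 + x\<^sup>2)"
proof -
  obtain M where M: "M \<ge> 0" "\<And>x y. x \<in> cball l0 (l0 / 2) \<Longrightarrow> y \<in> cball l0 (l0 / 2) \<Longrightarrow>
      norm (eigen_fibre u l0 x - eigen_fibre u l0 y) \<le> M * \<bar>x - y\<bar>"
    using eigen_fibre_lipschitz[OF u l0 zero] by blast
  obtain C C2 where C: "\<And>l. l > 0 \<Longrightarrow> norm (u l) \<le> C" "\<And>l. l \<ge> 1 \<Longrightarrow> l ^ 2 * norm (u l) \<le> C2"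
    using rapid_smooth_bounds[OF u] by blast
  have C0: "C \<ge> 0" using C(1)[of 1] norm_ge_zero[of "u 1"] by linarith
  \<comment> \<open>The sum of the bounds inside and outside the ball of radius l0 / 2, hence valid
    in both regions.\<close>
  define D where "D = norm (eigen_fibre u l0 l0) + M * (l0 / 2) + C / (l0 / 2)"
  have D: "norm (eigen_fibre u l0 x) \<le> D" if "x > 0" for x
  proof (cases "x \<in> cball l0 (l0 / 2)")
    case True
    have "norm (eigen_fibre u l0 x - eigen_fibre u l0 l0) \<le> M * \<bar>x - l0\<bar>"
      using True l0 by (intro M) auto
    also have "\<dots> \<le> M * (l0 / 2)"
      using True M(1) by (intro mult_left_mono) (auto simp: dist_real_def abs_minus_commute)
    finally have "norm (eigen_fibre u l0 x) \<le> norm (eigen_fibre u l0 l0) + M * (l0 / 2)"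
      using norm_triangle_sub[of "eigen_fibre u l0 x" "eigen_fibre u l0 l0"] by linarith
    moreover have "C / (l0 / 2) \<ge> 0" using C0 l0 by simp
    ultimately show ?thesis by (simp add: D_def)
  next
    case False
    then have d: "l0 / 2 \<le> \<bar>x - l0\<bar>" by (auto simp: dist_real_def abs_minus_commute)
    have "norm (eigen_fibre u l0 x) * (l0 / 2) \<le> norm (eigen_fibre u l0 x) * \<bar>x - l0\<bar>"
      using d by (intro mult_left_mono) auto
    also have "\<dots> \<le> C"
      using C(1)[OF that] norm_eigen_fibre[of u l0 x] zero by simp
    finally have "norm (eigen_fibre u l0 x) \<le> C / (l0 / 2)"
      using l0 by (subst pos_le_divide_eq) auto
    moreover have "norm (eigen_fibre u l0 l0) + M * (l0 / 2) \<ge> 0" using M l0 by simp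
    ultimately show ?thesis by (simp add: D_def)
  qed
  \<comment> \<open>Beyond \<open>N\<close> both x \<ge> 1 and |x - l0| \<ge> 1 hold, so the fibre
    is no larger than \<open>u\<close>, and (1 + x)(1 + x^2) \<le> 4 x^4 is absorbed by the decay
    with exponent 2.\<close>
  define N where "N = l0 + 1"
  define K where "K = (1 + N) * (1 + N\<^sup>2) * D\<^sup>2 + 4 * C2\<^sup>2"
  have "(1 + \<bar>x\<bar>) * (1 + x\<^sup>2) * eigen_density u l0 x \<le> K" for x
  proof (cases "x > 0")
    case x: True
    show ?thesis
    proof (cases "x \<le> N")
      case True
      have "(1 + x) * (1 + x\<^sup>2) * (norm (eigen_fibre u l0 x))\<^sup>2 \<le> (1 + N) * (1 + N\<^sup>2) * D\<^sup>2"
        using x True D[OF x] by (intro mult_mono power_mono add_mono) auto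
      then show ?thesis using x by (simp add: K_def eigen_density_def add_increasing2)
    next
      case False
      then have x1: "x \<ge> 1" "\<bar>x - l0\<bar> \<ge> 1" using l0 by (auto simp: N_def)
      have "norm (eigen_fibre u l0 x) * 1 \<le> norm (eigen_fibre u l0 x) * \<bar>x - l0\<bar>"
        using x1 by (intro mult_left_mono) auto
      also have "\<dots> = norm (u x)" by (rule norm_eigen_fibre[of u l0 x, OF zero])
      finally have "x\<^sup>2 * norm (eigen_fibre u l0 x) \<le> x\<^sup>2 * norm (u x)"
        by (intro mult_left_mono) auto
      with C(2)[OF x1(1)] have "x\<^sup>2 * norm (eigen_fibre u l0 x) \<le> C2" by linarith
      then have "(x\<^sup>2 * norm (eigen_fibre u l0 x))\<^sup>2 \<le> C2\<^sup>2"
        by (intro power_mono) auto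
      moreover have "(1 + x) * (1 + x\<^sup>2) \<le> (2 * x\<^sup>2) * (2 * x\<^sup>2)"
        using x1(1) self_le_power[of x 2] one_le_power[of x 2] by (intro mult_mono) auto
      then have "(1 + x) * (1 + x\<^sup>2) * (norm (eigen_fibre u l0 x))\<^sup>2 \<le>
          (2 * x\<^sup>2) * (2 * x\<^sup>2) * (norm (eigen_fibre u l0 x))\<^sup>2"
        by (rule mult_right_mono) auto
      moreover have "\<dots> = 4 * (x\<^sup>2 * norm (eigen_fibre u l0 x))\<^sup>2"
        by (simp add: power2_eq_square)
      moreover have "0 \<le> (1 + N) * (1 + N\<^sup>2) * D\<^sup>2" using l0 by (simp add: N_def)
      ultimately show ?thesis using x by (simp add: K_def eigen_density_def)
    qed
  next
    case False
    then show ?thesis using l0 by (simp add: K_def eigen_density_def N_def)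
  qed
  moreover have "0 < 1 + x\<^sup>2" for x :: real
    by (simp add: add_pos_nonneg)
  ultimately have "(1 + \<bar>x\<bar>) * eigen_density u l0 x \<le> K * inverse (1 + x\<^sup>2)" for x
    by (simp add: field_simps)
  with that show ?thesis by blast
qed

lemma borel_measurable_eigen_density:
  fixes u :: "real \<Rightarrow> 'a::measured L2"
  assumes "u \<in> rapid_smooth" "l0 > 0" "u l0 = 0"
  shows "eigen_density u l0 \<in> borel_measurable borel"
proof -
  have "continuous_on {0<..} (\<lambda>x. (norm (eigen_fibre u l0 x))\<^sup>2)"
    using isCont_eigen_fibre[OF assms]
    by (intro continuous_at_imp_continuous_on ballI continuous_intros) auto
  then have "(\<lambda>x. indicator {0<..} x *\<^sub>R (norm (eigen_fibre u l0 x))\<^sup>2) \<in> borel_measurable borel"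
    by (intro borel_measurable_continuous_on_indicator) auto
  also have "(\<lambda>x. indicator {0<..} x *\<^sub>R (norm (eigen_fibre u l0 x))\<^sup>2) = eigen_density u l0"
    by (auto simp: fun_eq_iff eigen_density_def indicator_def)
  finally show ?thesis .
qed

lemma eigen_density_nonneg [simp]: "0 \<le> eigen_density u l0 x"
  by (simp add: eigen_density_def)

lemma integrable_eigen_density:
  fixes u :: "real \<Rightarrow> 'a::measured L2"
  assumes "u \<in> rapid_smooth" "l0 > 0" "u l0 = 0"
  shows "integrable lborel (eigen_density u l0)" "integrable lborel (\<lambda>x. x * eigen_density u l0 x)"
proof -
  note [measurable] = borel_measurable_eigen_density[OF assms]
  obtain K where K: "\<And>x. (1 + \<bar>x\<bar>) * eigen_density u l0 x \<le> K * inverse (1 + x\<^sup>2)"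
    using eigen_density_bound[OF assms] by blast
  have "integrable lborel (\<lambda>x::real. inverse (1 + x\<^sup>2))"
    using integrable_inverse_1_plus_square by (simp add: set_integrable_def)
  then have I: "integrable lborel (\<lambda>x::real. K * inverse (1 + x\<^sup>2))"
    by simp
  have le: "norm (eigen_density u l0 x) \<le> norm (K * inverse (1 + x\<^sup>2))"
    "norm (x * eigen_density u l0 x) \<le> norm (K * inverse (1 + x\<^sup>2))" for x
  proof -
    have "(1 + \<bar>x\<bar>) * eigen_density u l0 x \<le> norm (K * inverse (1 + x\<^sup>2))"
      using K[of x] by (simp del: norm_mult)
    moreover have "0 \<le> eigen_density u l0 x" "0 \<le> \<bar>x\<bar> * eigen_density u l0 x"
      by simp_all
    ultimately show "norm (eigen_density u l0 x) \<le> norm (K * inverse (1 + x\<^sup>2))"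
      "norm (x * eigen_density u l0 x) \<le> norm (K * inverse (1 + x\<^sup>2))"
      unfolding distrib_right real_norm_def abs_mult abs_of_nonneg[OF eigen_density_nonneg]
      by linarith+
  qed
  show "integrable lborel (eigen_density u l0)"
    by (rule Bochner_Integration.integrable_bound[OF I _ AE_I2[OF le(1)]]) simp
  show "integrable lborel (\<lambda>x. x * eigen_density u l0 x)"
    by (rule Bochner_Integration.integrable_bound[OF I _ AE_I2[OF le(2)]]) simp
qed

lemma fibre_norm_eigen_fibre:
  "(fibre_norm (eigen_fibre u l0))\<^sup>2 = (\<integral>x. eigen_density u l0 x \<partial>lborel)"
proof -
  have "(LINT l:{0<..}|lborel. (norm (eigen_fibre u l0 l))\<^sup>2) = (\<integral>x. eigen_density u l0 x \<partial>lborel)"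
    unfolding set_lebesgue_integral_def
    by (intro Bochner_Integration.integral_cong) (auto simp: eigen_density_def)
  then show ?thesis
    by (simp add: fibre_norm_def)
qed

text \<open>A zero integral would make the density vanish almost everywhere, yet it is positive on
  the interval (l0, l0 + 1). Positivity is needed because \<open>kappa\<close> divides by this
  number.\<close>

lemma integral_eigen_density_pos:
  fixes u :: "real \<Rightarrow> 'a::measured L2"
  assumes u: "u \<in> rapid_smooth" "l0 > 0" and zero: "\<And>l. l > 0 \<Longrightarrow> u l = 0 \<longleftrightarrow> l = l0"
  shows "(\<integral>x. eigen_density u l0 x \<partial>lborel) > 0"
proof -
  have u0: "u l0 = 0" using u zero by simp
  have "\<not> (AE x in lborel. eigen_density u l0 x = 0)"
  proof
    assume "AE x in lborel. eigen_density u l0 x = 0"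
    then have "AE x in lborel. x \<notin> {l0<..<l0 + 1}"
      by eventually_elim (use zero u in \<open>auto simp: eigen_density_def eigen_fibre_def\<close>)
    moreover have "(AE x in lborel. x \<notin> {l0<..<l0 + 1}) \<longleftrightarrow> emeasure lborel {l0<..<l0 + 1} = 0"
      by (rule AE_iff_measurable) auto
    ultimately have "emeasure lborel {l0<..<l0 + 1} = 0"
      by blast
    then show False by simp
  qed
  then have "(\<integral>x. eigen_density u l0 x \<partial>lborel) \<noteq> 0"
    using integrable_eigen_density(1)[OF u u0]
    by (subst integral_nonneg_eq_0_iff_AE) auto
  moreover have "(\<integral>x. eigen_density u l0 x \<partial>lborel) \<ge> 0"
    by (rule Bochner_Integration.integral_nonneg) simp
  ultimately show ?thesis by linarith
qed

text \<open>Factor the difference of squares: the difference of norms is Lipschitz by the reverse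
  triangle inequality, and their sum is bounded by 2 P on the ball.\<close>

lemma eigen_density_lipschitz:
  fixes u :: "real \<Rightarrow> 'a::measured L2"
  assumes u: "u \<in> rapid_smooth" and l0: "l0 > 0" and zero: "u l0 = 0"
  obtains L where "\<And>x y. x \<in> cball l0 (l0 / 2) \<Longrightarrow> y \<in> cball l0 (l0 / 2) \<Longrightarrow>
    \<bar>eigen_density u l0 x - eigen_density u l0 y\<bar> \<le> L * \<bar>x - y\<bar>"
proof -
  let ?\<phi> = "eigen_fibre u l0"
  obtain M where M: "M \<ge> 0" "\<And>x y. x \<in> cball l0 (l0 / 2) \<Longrightarrow> y \<in> cball l0 (l0 / 2) \<Longrightarrow>
      norm (?\<phi> x - ?\<phi> y) \<le> M * \<bar>x - y\<bar>"
    using eigen_fibre_lipschitz[OF u l0 zero] by blast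
  define P where "P = norm (?\<phi> l0) + M * (l0 / 2)"
  have P: "norm (?\<phi> x) \<le> P" if x: "x \<in> cball l0 (l0 / 2)" for x
  proof -
    have "norm (?\<phi> x - ?\<phi> l0) \<le> M * \<bar>x - l0\<bar>"
      using x l0 by (intro M) auto
    also have "\<dots> \<le> M * (l0 / 2)"
      using x M(1) by (intro mult_left_mono) (auto simp: dist_real_def abs_minus_commute)
    finally show ?thesis
      using norm_triangle_sub[of "?\<phi> x" "?\<phi> l0"] by (simp add: P_def)
  qed
  have "\<bar>eigen_density u l0 x - eigen_density u l0 y\<bar> \<le> (M * (2 * P)) * \<bar>x - y\<bar>"
    if xy: "x \<in> cball l0 (l0 / 2)" "y \<in> cball l0 (l0 / 2)" for x y
  proof -
    have "x > 0" "y > 0" 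
      using xy l0 abs_ge_self[of "l0 - x"] abs_ge_self[of "l0 - y"] by (simp_all add: dist_real_def)
    then have "\<bar>eigen_density u l0 x - eigen_density u l0 y\<bar> =
        \<bar>norm (?\<phi> x) - norm (?\<phi> y)\<bar> * (norm (?\<phi> x) + norm (?\<phi> y))"
      by (simp add: eigen_density_def power2_eq_square square_diff_square_factored abs_mult)
    also have "\<dots> \<le> (M * \<bar>x - y\<bar>) * (P + P)"
      using P xy M(1)
      by (intro mult_mono add_mono order_trans[OF norm_triangle_ineq3 M(2)]) auto
    finally show ?thesis by (simp add: algebra_simps)
  qed
  with that show ?thesis by blast
qed

lemma pv_integral_fibre_inner:
  fixes u :: "real \<Rightarrow> 'a::measured L2"
  assumes u: "u \<in> rapid_smooth" "l0 > 0" "u l0 = 0"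
  obtains c0 \<Gamma> where "isCont \<Gamma> l0"
    "\<forall>\<^sub>F l in nhds l0. pv_integral (fibre_inner u u) l = complex_of_real
       (c0 + (l - l0) * (\<integral>x. eigen_density u l0 x \<partial>lborel) + (l - l0)\<^sup>2 * \<Gamma> l)"
proof -
  \<comment> \<open>Chosen so that radius \<open>2 * r\<close> is exactly the one on which the
    Lipschitz bound is available.\<close>
  define r where "r = l0 / 4"
  have r: "r > 0" "2 * r = l0 / 2" using u(2) by (simp_all add: r_def)
  obtain L where L: "\<And>x y. x \<in> cball l0 (2 * r) \<Longrightarrow> y \<in> cball l0 (2 * r) \<Longrightarrow>
      \<bar>eigen_density u l0 x - eigen_density u l0 y\<bar> \<le> L * \<bar>x - y\<bar>"
    using eigen_density_lipschitz[OF u] r(2) by metis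
  note int = integrable_eigen_density[OF u]
  have "\<forall>\<^sub>F l in nhds l0. l \<in> ball l0 r"
    using r(1) by (intro eventually_nhds_in_open) auto
  then have "\<forall>\<^sub>F l in nhds l0. pv_integral (fibre_inner u u) l = complex_of_real
       ((\<integral>x. (x - l0) * eigen_density u l0 x \<partial>lborel) +
        (l - l0) * (\<integral>x. eigen_density u l0 x \<partial>lborel) +
        (l - l0)\<^sup>2 * pv_split (eigen_density u l0) r l)"
  proof eventually_elim
    case (elim l)
    have "\<bar>eigen_density u l0 (l + t) - eigen_density u l0 l\<bar> \<le> L * \<bar>t\<bar>" if "\<bar>t\<bar> \<le> r" for t
      using L[of "l + t" l] elim that by (auto simp: dist_real_def)
    then show ?case
      unfolding fibre_inner_eigen_density[of u l0, OF u(3)]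
      by (intro pv_integral_quadratic[OF int r(1)])
  qed
  moreover have "isCont (pv_split (eigen_density u l0) r) l0"
    by (rule isCont_pv_split[OF int(1) r(1) L])
  ultimately show ?thesis using that by blast
qed

section \<open>Cancellation of the quadratic zero at the resonance\<close>

theorem theorem7p4:
  fixes \<alpha>0 l0 h :: real
    and u\<^sub>0 :: "(real^3) L2"
    and u :: "real \<Rightarrow> S2 L2"
    and J :: "real set"
    and lam :: "real \<Rightarrow> real"
    and S :: "real \<Rightarrow> real \<Rightarrow> S2 L2 \<Rightarrow> S2 L2"
  assumes "\<alpha>0 > 0" and "l0 > 0"
    and u_fibres: "AE l in lborel. l > 0 \<longrightarrow> spectral u\<^sub>0 l = u l"
    and u_smooth: "u \<in> rapid_smooth"
    and u_norm: "norm u\<^sub>0 = 1"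
    and u_zero: "\<And>l. l > 0 \<Longrightarrow> u l = 0 \<longleftrightarrow> l = l0"
    and resonance: "1 + complex_of_real \<alpha>0 * pv_integral (fibre_inner u u) l0 = 0"
    and u_deriv: "strong_deriv 1 u l0 \<noteq> 0"
    and J: "open J" "is_interval J" "J \<subseteq> {0<..}" "\<alpha>0 \<in> J"
    and lam: "lam C1_differentiable_on J" "\<And>\<alpha>. \<alpha> \<in> J \<Longrightarrow> lam \<alpha> > 0" "lam \<alpha>0 = l0"
      "\<And>\<alpha>. \<alpha> \<in> J \<Longrightarrow> G1 u \<alpha> (lam \<alpha>) = 0"
    and S: "\<And>\<alpha>. \<alpha> > 0 \<Longrightarrow> \<alpha> \<noteq> \<alpha>0 \<Longrightarrow> scattering_matrix (H_pert u\<^sub>0 \<alpha>) (S \<alpha>)"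
    and S_formula: "\<And>\<alpha> l. \<alpha> > 0 \<Longrightarrow> \<alpha> \<noteq> \<alpha>0 \<Longrightarrow> l > 0 \<Longrightarrow>
      S \<alpha> l = (\<lambda>v. v - (2 * pi * \<i> * \<alpha> / G u \<alpha> l) *\<^sub>C rank_one (u l) v)"
  defines "R \<equiv> \<lambda>\<alpha> l v. S \<alpha> l v - v"
    and "lam_h \<equiv> \<lambda>\<alpha>. lam \<alpha> + h * kappa u l0 lam \<alpha>"
    and "e \<equiv> strong_deriv 1 u l0 /\<^sub>R norm (strong_deriv 1 u l0)"
  shows "tendsto_hs (\<lambda>\<alpha>. R \<alpha> (lam_h \<alpha>)) (\<lambda>v. (- (2 * \<i> / (h + \<i>))) *\<^sub>C rank_one e v) (at \<alpha>0)"
proof -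
  have u0: "u l0 = 0" using u_zero \<open>l0 > 0\<close> by simp
  note u = u_smooth \<open>l0 > 0\<close> u0
  define \<phi> where "\<phi> = eigen_fibre u l0"
  define q where "q = (\<lambda>x. (norm (\<phi> x))\<^sup>2)"
  define Q where "Q = (\<integral>x. eigen_density u l0 x \<partial>lborel)"
  have Q: "Q > 0"
    unfolding Q_def by (rule integral_eigen_density_pos[OF u(1,2) u_zero])
  have cont_\<phi>: "isCont \<phi> l0"
    unfolding \<phi>_def by (rule isCont_eigen_fibre[OF u u(2)])
  then have cont_q: "isCont q l0"
    unfolding q_def by (intro continuous_intros)
  have \<phi>_l0: "\<phi> l0 = strong_deriv 1 u l0"
    by (simp add: \<phi>_def eigen_fibre_def)
  then have q_l0: "q l0 > 0"
    using u_deriv by (simp add: q_def)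
  have norm_u: "(norm (u x))\<^sup>2 = (x - l0)\<^sup>2 * q x" for x
    by (simp add: q_def \<phi>_def norm_eigen_fibre[of u l0 x, OF u0, symmetric] power_mult_distrib)
  obtain c0 \<Gamma> where cont_\<Gamma>: "isCont \<Gamma> l0" and pv: "\<forall>\<^sub>F l in nhds l0.
      pv_integral (fibre_inner u u) l = complex_of_real (c0 + (l - l0) * Q + (l - l0)\<^sup>2 * \<Gamma> l)"
    using pv_integral_fibre_inner[OF u] unfolding Q_def by blast

  define \<delta> where "\<delta> = (\<lambda>\<alpha>. lam \<alpha> - l0)"
  \<comment> \<open>The ratio of lam_h - l0 to lam - l0. As \<open>kappa\<close> is quadratic in
    \<delta>, the shift by h is of higher order and the ratio tends to 1.\<close>
  define \<rho> where "\<rho> = (\<lambda>\<alpha>. 1 + h * pi * \<delta> \<alpha> * q (lam \<alpha>) / Q)"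
  \<comment> \<open>What remains of G(\<alpha>, lam_h) after removing the factor \<alpha>
    \<delta>^2. In the limit the two \<Gamma> terms cancel, because both arguments tend to
    \<open>l0\<close>, where \<Gamma> is continuous.\<close>
  define Z where "Z = (\<lambda>\<alpha>. complex_of_real (h * pi * q (lam \<alpha>) + (\<rho> \<alpha>)\<^sup>2 * \<Gamma> (lam_h \<alpha>) - \<Gamma> (lam \<alpha>))
      + \<i> * complex_of_real (pi * (\<rho> \<alpha>)\<^sup>2 * q (lam_h \<alpha>)))"
  have lam_h: "lam_h \<alpha> - l0 = \<rho> \<alpha> * \<delta> \<alpha>" for \<alpha>
  proof -
    have "kappa u l0 lam \<alpha> = pi * ((\<delta> \<alpha>)\<^sup>2 * q (lam \<alpha>)) / Q"
      by (simp only: kappa_def fibre_norm_eigen_fibre norm_u Q_def \<delta>_def)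
    then have "lam_h \<alpha> - l0 = \<delta> \<alpha> + h * (pi * ((\<delta> \<alpha>)\<^sup>2 * q (lam \<alpha>)) / Q)"
      by (simp add: lam_h_def \<delta>_def)
    then show ?thesis
      by (simp add: \<rho>_def power2_eq_square algebra_simps)
  qed

  have "isCont lam \<alpha>0"
    using C1_differentiable_imp_continuous_on[OF lam(1)] J continuous_on_eq_continuous_at by blast
  then have lim_lam: "lam \<midarrow>\<alpha>0\<rightarrow> l0"
    using lam(3) by (simp add: isCont_def)
  then have lim_\<delta>: "\<delta> \<midarrow>\<alpha>0\<rightarrow> 0"
    unfolding \<delta>_def by (rule LIM_zero)
  have lim_q: "(\<lambda>\<alpha>. q (lam \<alpha>)) \<midarrow>\<alpha>0\<rightarrow> q l0"
    by (rule isCont_tendsto_compose[OF cont_q lim_lam])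
  have "\<rho> \<midarrow>\<alpha>0\<rightarrow> 1 + h * pi * 0 * q l0 / Q"
    unfolding \<rho>_def using Q by (intro tendsto_intros lim_\<delta> lim_q) auto
  then have lim_\<rho>: "\<rho> \<midarrow>\<alpha>0\<rightarrow> 1" by simp
  have "(\<lambda>\<alpha>. l0 + \<rho> \<alpha> * \<delta> \<alpha>) \<midarrow>\<alpha>0\<rightarrow> l0 + 1 * 0"
    by (intro tendsto_intros lim_\<delta> lim_\<rho>)
  moreover have "(\<lambda>\<alpha>. l0 + \<rho> \<alpha> * \<delta> \<alpha>) = lam_h"
    by (simp add: lam_h[symmetric])
  ultimately have lim_lam_h: "lam_h \<midarrow>\<alpha>0\<rightarrow> l0" by simp
  have "Z \<midarrow>\<alpha>0\<rightarrow> complex_of_real (h * pi * q l0 + 1\<^sup>2 * \<Gamma> l0 - \<Gamma> l0)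
      + \<i> * complex_of_real (pi * 1\<^sup>2 * q l0)"
    unfolding Z_def
    by (intro tendsto_intros lim_\<rho> lim_q isCont_tendsto_compose[OF cont_q lim_lam_h]
        isCont_tendsto_compose[OF cont_\<Gamma> lim_lam_h] isCont_tendsto_compose[OF cont_\<Gamma> lim_lam])
  moreover have "complex_of_real (h * pi * q l0 + 1\<^sup>2 * \<Gamma> l0 - \<Gamma> l0)
      + \<i> * complex_of_real (pi * 1\<^sup>2 * q l0) = pi * q l0 * (h + \<i>)"
    by (simp add: algebra_simps)
  ultimately have lim_Z: "Z \<midarrow>\<alpha>0\<rightarrow> pi * q l0 * (h + \<i>)" by simp
  have hi: "complex_of_real h + \<i> \<noteq> 0"
    by (simp add: complex_eq_iff)
  have "(\<lambda>\<alpha>. - (2 * pi * \<i> * complex_of_real ((\<rho> \<alpha>)\<^sup>2) / Z \<alpha>)) \<midarrow>\<alpha>0\<rightarrow>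
      - (2 * pi * \<i> * complex_of_real (1\<^sup>2) / (pi * q l0 * (h + \<i>)))"
    using hi q_l0 by (intro tendsto_intros lim_\<rho> lim_Z) auto
  then have lim: "tendsto_hs
      (\<lambda>\<alpha> v. (- (2 * pi * \<i> * complex_of_real ((\<rho> \<alpha>)\<^sup>2) / Z \<alpha>)) *\<^sub>C rank_one (\<phi> (lam_h \<alpha>)) v)
      (\<lambda>v. (- (2 * pi * \<i> * complex_of_real (1\<^sup>2) / (pi * q l0 * (h + \<i>)))) *\<^sub>C rank_one (\<phi> l0) v)
      (at \<alpha>0)"
    by (intro tendsto_hs_rank_one isCont_tendsto_compose[OF cont_\<phi> lim_lam_h])
  have limit_eq: "(- (2 * pi * \<i> * complex_of_real (1\<^sup>2) / (pi * q l0 * (h + \<i>)))) *\<^sub>C rank_one (\<phi> l0) v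
      = (- (2 * \<i> / (h + \<i>))) *\<^sub>C rank_one e v" for v
  proof -
    have "rank_one e v = complex_of_real ((inverse (norm (\<phi> l0)))\<^sup>2) *\<^sub>C rank_one (\<phi> l0) v"
      by (simp only: e_def \<phi>_l0[symmetric] rank_one_scaleR)
    also have "(inverse (norm (\<phi> l0)))\<^sup>2 = inverse (q l0)"
      by (simp add: q_def power_inverse)
    finally have "rank_one e v = complex_of_real (inverse (q l0)) *\<^sub>C rank_one (\<phi> l0) v" .
    \<comment> \<open>Stated for arbitrary nonzero complex numbers in place of pi,
      \<open>q l0\<close> and h + i, so that simplification does not rewrite their real
      embeddings.\<close>
    moreover have "- (2 * p * \<i> * complex_of_real (1\<^sup>2) / (p * c * w)) = - (2 * \<i> / w) * inverse c"
      if "p \<noteq> 0" "c \<noteq> 0" "w \<noteq> 0" for p c w :: complex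
      using that by (simp add: field_simps)
    ultimately show ?thesis
      using q_l0 hi by (simp add: scaleC_scaleC)
  qed

  have "\<forall>\<^sub>F \<alpha> in at \<alpha>0. \<alpha> \<in> J"
    using J by (intro eventually_at_in_open') auto
  moreover have "\<forall>\<^sub>F \<alpha> in at \<alpha>0. lam_h \<alpha> > 0"
    using order_tendstoD(1)[OF lim_lam_h \<open>l0 > 0\<close>] .
  moreover have "\<forall>\<^sub>F \<alpha> in at \<alpha>0. \<alpha> \<noteq> \<alpha>0"
    by (rule eventually_neq_at_within)
  moreover note eventually_compose_filterlim[OF pv lim_lam] eventually_compose_filterlim[OF pv lim_lam_h]
  ultimately have "\<forall>\<^sub>F \<alpha> in at \<alpha>0.
      (\<lambda>v. (- (2 * pi * \<i> * complex_of_real ((\<rho> \<alpha>)\<^sup>2) / Z \<alpha>)) *\<^sub>C rank_one (\<phi> (lam_h \<alpha>)) v) =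
      R \<alpha> (lam_h \<alpha>)"
  proof eventually_elim
    case (elim \<alpha>)
    have \<alpha>: "\<alpha> > 0" using elim J by auto
    \<comment> \<open>Otherwise \<open>G1\<close> would vanish at \<open>l0\<close> for both
      \<alpha> and \<open>\<alpha>0\<close>. The principal value there is nonzero by the resonance
      condition, which forces the two couplings to agree.\<close>
    have "lam \<alpha> \<noteq> l0"
    proof
      assume "lam \<alpha> = l0"
      then have "complex_of_real \<alpha> * pv_integral (fibre_inner u u) l0 =
          complex_of_real \<alpha>0 * pv_integral (fibre_inner u u) l0"
        using lam(4)[OF \<open>\<alpha> \<in> J\<close>] resonance by (simp add: G1_def add_eq_0_iff)
      moreover have "pv_integral (fibre_inner u u) l0 \<noteq> 0"
        using resonance by auto
      ultimately show False using \<open>\<alpha> \<noteq> \<alpha>0\<close> by simp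
    qed
    then have \<delta>: "\<delta> \<alpha> \<noteq> 0" by (simp add: \<delta>_def)
    have step: "lam_h \<alpha> - lam \<alpha> = h * pi * (\<delta> \<alpha>)\<^sup>2 * q (lam \<alpha>) / Q"
      using lam_h[of \<alpha>] by (simp add: \<rho>_def \<delta>_def power2_eq_square algebra_simps)
    \<comment> \<open>Subtracting this zero removes 1 + \<alpha> c0, so the constant
      \<open>c0\<close> is never evaluated.\<close>
    have "G1 u \<alpha> (lam_h \<alpha>) = G1 u \<alpha> (lam_h \<alpha>) - G1 u \<alpha> (lam \<alpha>)"
      using lam(4)[OF \<open>\<alpha> \<in> J\<close>] by simp
    also have "\<dots> = complex_of_real (\<alpha> * ((lam_h \<alpha> - lam \<alpha>) * Q
        + (lam_h \<alpha> - l0)\<^sup>2 * \<Gamma> (lam_h \<alpha>) - (\<delta> \<alpha>)\<^sup>2 * \<Gamma> (lam \<alpha>)))"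
      unfolding G1_def elim(4,5) by (simp add: \<delta>_def algebra_simps)
    \<comment> \<open>The normalisation of \<open>kappa\<close> by \<open>Q\<close> is used here:
      the linear term (lam_h - lam) Q becomes h pi \<delta>^2 q(lam), of the same order as
      \<open>G2\<close>.\<close>
    also have "\<dots> = complex_of_real (\<alpha> * (\<delta> \<alpha>)\<^sup>2 *
        (h * pi * q (lam \<alpha>) + (\<rho> \<alpha>)\<^sup>2 * \<Gamma> (lam_h \<alpha>) - \<Gamma> (lam \<alpha>)))"
      unfolding step lam_h using Q by (simp add: power_mult_distrib algebra_simps)
    finally have "G u \<alpha> (lam_h \<alpha>) = complex_of_real (\<alpha> * (\<delta> \<alpha>)\<^sup>2) * Z \<alpha>"
      by (simp add: G_def G2_def Z_def norm_u lam_h power_mult_distrib algebra_simps)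
    \<comment> \<open>Only \<alpha> and \<delta> have to be nonzero for this cancellation; were
      \<open>Z\<close> zero, both sides would be 0 by the division convention.\<close>
    then have "- (2 * pi * \<i> * \<alpha> / G u \<alpha> (lam_h \<alpha>)) * complex_of_real ((\<rho> \<alpha> * \<delta> \<alpha>)\<^sup>2) =
        - (2 * pi * \<i> * complex_of_real ((\<rho> \<alpha>)\<^sup>2) / Z \<alpha>)"
      using \<alpha> \<delta> by (simp add: divide_simps power_mult_distrib)
    moreover have "R \<alpha> (lam_h \<alpha>) v =
        (- (2 * pi * \<i> * \<alpha> / G u \<alpha> (lam_h \<alpha>)) * complex_of_real ((\<rho> \<alpha> * \<delta> \<alpha>)\<^sup>2)) *\<^sub>C
          rank_one (\<phi> (lam_h \<alpha>)) v" for v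
    proof -
      have "u (lam_h \<alpha>) = (\<rho> \<alpha> * \<delta> \<alpha>) *\<^sub>R \<phi> (lam_h \<alpha>)"
        using eigen_fibre_scaleR[of u l0 "lam_h \<alpha>", OF u0] by (simp add: \<phi>_def lam_h)
      then have "rank_one (u (lam_h \<alpha>)) v =
          complex_of_real ((\<rho> \<alpha> * \<delta> \<alpha>)\<^sup>2) *\<^sub>C rank_one (\<phi> (lam_h \<alpha>)) v"
        by (simp only: rank_one_scaleR)
      then show ?thesis
        unfolding R_def S_formula[OF \<alpha> \<open>\<alpha> \<noteq> \<alpha>0\<close> \<open>lam_h \<alpha> > 0\<close>] scaleC_scaleC[symmetric]
        by (simp add: scaleC_minus_left)
    qed
    ultimately show ?case by (simp add: fun_eq_iff)
  qed
  from tendsto_hs_cong[OF lim this] show ?thesis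
    unfolding limit_eq .
qed

end
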